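(* Let $k$ and $\varepsilon$ be any real numbers with $\varepsilon > 0$. Then there exists a positive integer $n(k,\varepsilon)$, depending only on $k$ and $\varepsilon$, such that for all integers $n \geq n(k,\varepsilon)$, $$(2 - \varepsilon)\,p_{n+2}^k < p_{n+1}^k + p_n^k < (2 + \varepsilon)\,p_{n+2}^k,$$ where $p_n$ denotes the $n$th prime number.
   Context: The primes are indexed in increasing order starting from $n=1$: $p_1 = 2$, $p_2 = 3$, $p_3 = 5$, and so on. The exponent $k$ is an arbitrary real number (possibly negative or zero), and $p^k$ denotes the real power of the positive real number $p$. *)

theory Defs
  imports Complex_Main "HOL-Library.Infinite_Set" "HOL-Computational_Algebra.Primes"
begin

(* The library function enumerate counts from 0, whereas here the first prime has index 1.
   The value nth_prime 0 = 2 is an artefact of truncated subtraction and carries no meaning. *)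
definition nth_prime :: "nat \<Rightarrow> nat" where
  "nth_prime n = enumerate {p. prime p} (n - 1)"

lemma prime_nth_prime: "prime (nth_prime n)"
  using enumerate_in_set[OF primes_infinite] by (simp add: nth_prime_def)

lemma strict_mono_on_nth_prime: "strict_mono_on {1..} nth_prime"
  by (rule strict_mono_onI) (auto simp: nth_prime_def intro!: enumerate_mono primes_infinite)

lemma nth_prime_surj:
  assumes "prime p"
  shows "\<exists>n\<ge>1. nth_prime n = p"
proof -
  obtain m where "enumerate {p::nat. prime p} m = p"
    using enumerate_Ex[of "{p::nat. prime p}" p] assms primes_infinite by auto
  then have "nth_prime (Suc m) = p" by (simp add: nth_prime_def)
  then show ?thesis by (intro exI[of _ "Suc m"]) simp
qed

lemma nth_prime_1: "nth_prime 1 = 2"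
  unfolding nth_prime_def enumerate_0 diff_self_eq_0
  by (rule Least_equality) (auto dest: prime_ge_2_nat)

end

(*
  Since powers are continuous, it suffices that p(n+1)/p(n) tends to 1, i.e. that for every r > 1 the
  interval (x, r x] contains a prime once x is large.  This is of the strength of the prime number
  theorem.  Let Lambda be the von Mangoldt function.  The function zeta1 s = (s - 1) zeta(s) is
  holomorphic for Re s > 0 and has no zeros with Re s >= 1, so the Dirichlet series of Lambda minus
  1/(s - 1) extends continuously to the line Re s = 1.  Take Selberg's minorant F: a real function
  whose Fourier transform K is supported in [-1,1], with F <= 0 outside [-2 pi, 2 pi] and K(0) > 0.
  For fixed l > 0, the sums of Lambda(n) n^(-x) F(l (ln n - y)) are, as x -> 1+, bounded below by a
  quantity that tends to a positive constant as y -> infinity (Riemann-Lebesgue and Dirichlet's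
  integral).  If no prime p had |ln p - y| <= 2 pi / l, then only proper prime powers could contribute
  positively, and their contribution tends to 0, a contradiction.  As F changes sign, no Chebyshev
  bound for the tails is needed.
*)
theory Submission
  imports Defs "HOL-Probability.Sinc_Integral" "HOL-Complex_Analysis.Conformal_Mappings"
    "HOL-Number_Theory.Prime_Powers"
begin

section \<open>Selberg's minorant and the Riemann-Lebesgue lemma\<close>

text \<open>With a nonnegative test function, primes far from y would contribute and would have to
  be estimated. F discards every n outside the window by its sign alone. As K has compact support,
  each l involves only the segment 0 <= Im s <= l of the line Re s = 1, where continuity and
  compactness give all bounds. Origin of K: \<open>1 - t\<close> is the Fejer triangle, with
  transform (1 - cos u) / u^2, which has double zeros at the nonzero multiples of 2 pi. The factor 4
  pi^2 / (4 pi^2 - u^2) uses up one zero at each of u = 2 pi and u = -2 pi and so creates the sign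
  change there. By partial fractions, this factor amounts to adding sin(2 pi t) / (2 pi) to the
  triangle. Origin of the positive constant: near Re s = 1 the pole 1 / (s - 1) splits into a
  Poisson kernel and a conjugate Poisson kernel, each worth pi K(0) / (2 l) in the limit, where K(0)
  = 1. The second is evaluated exactly; for the first the lower bound 0 is enough. This leaves pi /
  (2 l).\<close>

definition selberg_kernel :: "real \<Rightarrow> real" where
  "selberg_kernel t = 1 - t + sin (2 * pi * t) / (2 * pi)"

text \<open>This is half of Selberg's function (sin(u/2) / (u/2))^2 / (1 - (u / (2 pi))^2), as the
  cosine transform of the even extension of the kernel. The integral form gives the values at u = 0
  and u = \<plusminus> 2 pi without case distinctions, and can be exchanged directly with the
  Dirichlet series.\<close>

definition selberg_minorant :: "real \<Rightarrow> real" where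
  "selberg_minorant u = integral {0..1} (\<lambda>t. selberg_kernel t * cos (u * t))"

lemma continuous_on_selberg_kernel [continuous_intros]:
  fixes f :: "'a :: t2_space \<Rightarrow> real"
  shows "continuous_on A f \<Longrightarrow> continuous_on A (\<lambda>x. selberg_kernel (f x))"
  unfolding selberg_kernel_def by (auto intro!: continuous_intros)

lemma abs_selberg_kernel_le:
  assumes "t \<in> {0..1}"
  shows "\<bar>selberg_kernel t\<bar> \<le> 2"
proof -
  have "\<bar>sin (2 * pi * t) / (2 * pi)\<bar> \<le> 1 / (2 * pi)"
    by (simp add: field_simps)
  also have "\<dots> \<le> 1"
    using pi_gt3 by (simp add: field_simps)
  finally have "\<bar>sin (2 * pi * t) / (2 * pi)\<bar> \<le> 1" .
  then show ?thesis
    using assms unfolding selberg_kernel_def atLeastAtMost_iff by linarith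
qed

lemma selberg_kernel_nonneg:
  assumes "0 \<le> t" "t \<le> 1 / 2"
  shows "selberg_kernel t \<ge> 0"
proof -
  have "sin (2 * pi * t) \<ge> 0"
    using assms mult_left_mono[of t "1/2" "2 * pi"] by (intro sin_ge_zero) auto
  then show ?thesis
    using assms by (simp add: selberg_kernel_def)
qed

lemma abs_selberg_minorant_le: "\<bar>selberg_minorant u\<bar> \<le> 2"
proof -
  have "norm (integral {0..1} (\<lambda>t. selberg_kernel t * cos (u * t))) \<le> 2 * (1 - 0)"
  proof (rule integral_bound)
    fix t :: real assume "t \<in> {0..1}"
    then have "\<bar>selberg_kernel t\<bar> * \<bar>cos (u * t)\<bar> \<le> 2 * 1"
      by (intro mult_mono abs_selberg_kernel_le) auto
    then show "norm (selberg_kernel t * cos (u * t)) \<le> 2"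
      by (simp add: abs_mult)
  qed (auto intro!: continuous_intros)
  then show ?thesis
    by (simp add: selberg_minorant_def)
qed

text \<open>The triangle contributes (1 - cos u) / u^2 and the sine contributes (1 - cos u) / (4
  pi^2 - u^2). The sign can be read off once both are over the common denominator.\<close>

lemma selberg_minorant_eq:
  assumes "\<bar>u\<bar> > 2 * pi"
  shows "selberg_minorant u = 4 * pi\<^sup>2 * (1 - cos u) / (u\<^sup>2 * (4 * pi\<^sup>2 - u\<^sup>2))"
proof -
  define a where "a = 2 * pi + u"
  define b where "b = 2 * pi - u"
  have nz: "u \<noteq> 0" "a \<noteq> 0" "b \<noteq> 0"
    using assms pi_gt3 by (auto simp: a_def b_def)
  \<comment> \<open>An antiderivative: parts for the triangle, and for the sine the product-to-sum
    formula, which shifts the frequency u to \<open>a\<close> and \<open>b\<close>.\<close>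
  define G where "G t = (1 - t) * (sin (u * t) / u) - cos (u * t) / u / u
      - (cos (a * t) / a + cos (b * t) / b) / (4 * pi)" for t
  have *: "sin (2 * pi * t) * cos (u * t) = (sin (a * t) + sin (b * t)) / 2" for t
  proof -
    have "2 * pi * t + u * t = a * t" "2 * pi * t - u * t = b * t"
      by (simp_all add: a_def b_def algebra_simps)
    then show ?thesis by (simp add: sin_times_cos)
  qed
  have dsin: "((\<lambda>t. sin (c * t) / c) has_real_derivative cos (c * t)) (at t within {0..1})"
    and dcos: "((\<lambda>t. cos (c * t) / c) has_real_derivative - sin (c * t)) (at t within {0..1})"
    if "c \<noteq> 0" for c t
    using that by (auto intro!: derivative_eq_intros)
  have "((\<lambda>t. 1 - t) has_real_derivative -1) (at t within {0..1})" for t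
    by (auto intro!: derivative_eq_intros)
  from DERIV_mult[OF this dsin[OF nz(1)]] dcos[OF nz(1)] dcos[OF nz(2)] dcos[OF nz(3)]
  have "(G has_real_derivative
      (-1 * (sin (u * t) / u) + cos (u * t) * (1 - t)) - (- sin (u * t)) / u
        - (- sin (a * t) + - sin (b * t)) / (4 * pi)) (at t within {0..1})" for t
    unfolding G_def by (intro DERIV_diff DERIV_add DERIV_cdivide)
  moreover have "(-1 * (sin (u * t) / u) + cos (u * t) * (1 - t)) - (- sin (u * t)) / u
        - (- sin (a * t) + - sin (b * t)) / (4 * pi) = selberg_kernel t * cos (u * t)" for t
  proof -
    have "(sin (a * t) + sin (b * t)) / (4 * pi) = sin (2 * pi * t) / (2 * pi) * cos (u * t)"
    proof -
      have "sin (a * t) + sin (b * t) = 2 * (sin (2 * pi * t) * cos (u * t))"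
        using *[of t] by simp
      then show ?thesis by simp
    qed
    moreover have "(- x + - y) / z = - ((x + y) / z)" for x y z :: real
      by (simp add: minus_divide_left)
    ultimately have "(- sin (a * t) + - sin (b * t)) / (4 * pi) = - (sin (2 * pi * t) / (2 * pi) * cos (u * t))"
      by simp
    then show ?thesis
      unfolding selberg_kernel_def by (simp only: ring_distribs) simp
  qed
  ultimately have "(G has_real_derivative selberg_kernel t * cos (u * t)) (at t within {0..1})" for t
    by simp
  then have "((\<lambda>t. selberg_kernel t * cos (u * t)) has_integral (G 1 - G 0)) {0..1}"
    by (intro fundamental_theorem_of_calculus)
       (auto simp: has_real_derivative_iff_has_vector_derivative)
  then have "selberg_minorant u = G 1 - G 0"
    by (simp add: selberg_minorant_def integral_unique)
  also have "\<dots> = (1 - cos u) / u\<^sup>2 + (1 - cos u) * ((1 / a + 1 / b) / (4 * pi))"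
  proof -
    have "cos a = cos u" "cos b = cos u"
      by (simp_all add: a_def b_def cos_add cos_diff)
    then have "G 1 - G 0 = 1 / u\<^sup>2 - cos u / u\<^sup>2
        + ((1 / a + 1 / b) / (4 * pi) - cos u * (1 / a + 1 / b) / (4 * pi))"
      by (simp add: G_def power2_eq_square distrib_left)
    also have "\<dots> = (1 - cos u) / u\<^sup>2 + (1 - cos u) * ((1 / a + 1 / b) / (4 * pi))"
      by (simp add: diff_divide_distrib left_diff_distrib)
    finally show ?thesis .
  qed
  also have "(1 / a + 1 / b) / (4 * pi) = 1 / (4 * pi\<^sup>2 - u\<^sup>2)"
  proof -
    have "a * b = 4 * pi\<^sup>2 - u\<^sup>2" "a + b = 4 * pi"
      by (simp_all add: a_def b_def power2_eq_square algebra_simps)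
    moreover have "1 / a + 1 / b = (a + b) / (a * b)"
      using nz by (simp add: add_divide_distrib)
    ultimately show ?thesis by simp
  qed
  also have "(1 - cos u) / u\<^sup>2 + (1 - cos u) * (1 / (4 * pi\<^sup>2 - u\<^sup>2)) =
      4 * pi\<^sup>2 * (1 - cos u) / (u\<^sup>2 * (4 * pi\<^sup>2 - u\<^sup>2))"
  proof -
    have "4 * pi\<^sup>2 - u\<^sup>2 = a * b"
      by (simp_all add: a_def b_def power2_eq_square algebra_simps)
    then have "4 * pi\<^sup>2 - u\<^sup>2 \<noteq> 0" using nz by simp
    moreover have "c / x + c * (1 / y) = (x + y) * c / (x * y)" if "x \<noteq> 0" "y \<noteq> 0" for c x y :: real
      using that by (simp add: add_divide_distrib ring_distribs)
    ultimately show ?thesis using nz by (metis power_not_zero diff_add_cancel add.commute)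
  qed
  finally show ?thesis .
qed

lemma selberg_minorant_nonpos:
  assumes "\<bar>u\<bar> > 2 * pi"
  shows "selberg_minorant u \<le> 0"
proof -
  have "(2 * pi)\<^sup>2 < u\<^sup>2"
    using power_strict_mono[of "2 * pi" "\<bar>u\<bar>" 2] assms by simp
  then have "4 * pi\<^sup>2 - u\<^sup>2 < 0"
    by (simp add: power2_eq_square)
  then show ?thesis
    unfolding selberg_minorant_eq[OF assms]
    by (intro divide_nonneg_nonpos mult_nonneg_nonpos mult_nonneg_nonneg) auto
qed

text \<open>For a polynomial \<open>p\<close>, one integration by parts gives O(1/y). A continuous
  \<open>G\<close> is uniformly close to such a \<open>p\<close>, and since \<open>cis\<close> has
  modulus 1 the replacement costs at most e/2, uniformly in y.\<close>

lemma Riemann_Lebesgue_continuous: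
  fixes G :: "real \<Rightarrow> complex"
  assumes "continuous_on {0..1} G"
  shows "((\<lambda>y. integral {0..1} (\<lambda>t. cis (y * t) * G t)) \<longlongrightarrow> 0) at_top"
proof (rule tendstoI)
  fix e :: real assume e: "e > 0"
  obtain p where p: "polynomial_function p" "\<And>t. t \<in> {0..1} \<Longrightarrow> norm (G t - p t) < e / 2"
    using Stone_Weierstrass_polynomial_function[OF _ assms, of "e / 2"] e by auto
  obtain p' where p': "polynomial_function p'" "\<And>x. (p has_vector_derivative (p' x)) (at x)"
    using has_vector_derivative_polynomial_function[OF p(1)] by blast
  have cont: "continuous_on {0..1} p" "continuous_on {0..1} p'"
    using p(1) p'(1) continuous_on_polymonial_function by blast+
  obtain C where C: "\<And>t. t \<in> {0..1} \<Longrightarrow> norm (p' t) \<le> C"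
    using compact_continuous_image[OF cont(2)] compact_imp_bounded
    by (metis bounded_iff compact_Icc image_eqI)
  define D where "D = norm (p 1) + norm (p 0) + C"
  have bound: "norm (integral {0..1} (\<lambda>t. cis (y * t) * p t)) \<le> D / y" if y: "y > 0" for y
  proof -
    have der: "((\<lambda>t. cis (y * t) / (\<i> * y) * p t) has_vector_derivative
            (cis (y * t) / (\<i> * y) * p' t + cis (y * t) * p t)) (at t within {0..1})" for t
    proof -
      have "((\<lambda>t. cis (y * t) / (\<i> * y)) has_vector_derivative cis (y * t)) (at t within {0..1})"
      proof -
        have "((\<lambda>z. exp (\<i> * y * z) / (\<i> * y)) has_field_derivative exp (\<i> * y * of_real t)) (at (of_real t))"
          using y by (auto intro!: derivative_eq_intros)
        from has_vector_derivative_real_field[OF this] show ?thesis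
          by (simp add: cis_conv_exp mult.assoc)
      qed
      moreover have "(p has_vector_derivative (p' t)) (at t within {0..1})"
        using p'(2) has_vector_derivative_at_within by blast
      ultimately show ?thesis by (rule has_vector_derivative_mult)
    qed
    have "((\<lambda>t. cis (y * t) / (\<i> * y) * p' t + cis (y * t) * p t) has_integral
        (cis (y * 1) / (\<i> * y) * p 1 - cis (y * 0) / (\<i> * y) * p 0)) {0..1}"
      by (rule fundamental_theorem_of_calculus) (use der in auto)
    moreover have int: "(\<lambda>t. cis (y * t) / (\<i> * y) * p' t) integrable_on {0..1}"
      using y by (intro integrable_continuous_interval continuous_intros cont) auto
    ultimately have "((\<lambda>t. cis (y * t) * p t) has_integral
        (cis (y * 1) / (\<i> * y) * p 1 - cis (y * 0) / (\<i> * y) * p 0) -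
        integral {0..1} (\<lambda>t. cis (y * t) / (\<i> * y) * p' t)) {0..1}"
      using has_integral_diff[OF _ integrable_integral[OF int]] by fastforce
    then have eq: "integral {0..1} (\<lambda>t. cis (y * t) * p t) =
        cis (y * 1) / (\<i> * y) * p 1 - cis (y * 0) / (\<i> * y) * p 0 -
        integral {0..1} (\<lambda>t. cis (y * t) / (\<i> * y) * p' t)"
      by (rule integral_unique)
    have I: "norm (integral {0..1} (\<lambda>t. cis (y * t) / (\<i> * y) * p' t)) \<le> C / y * (1 - 0)"
      using y C by (intro integral_bound)
        (auto intro!: continuous_intros cont simp: norm_mult norm_divide divide_right_mono)
    have N: "norm (cis (y * 1) / (\<i> * y) * p 1) = norm (p 1) / y"
        "norm (cis (y * 0) / (\<i> * y) * p 0) = norm (p 0) / y"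
      using y by (simp_all add: norm_mult norm_divide)
    have T: "norm (a - b - c) \<le> norm a + norm b + norm c" for a b c :: complex
      by norm
    have "norm (integral {0..1} (\<lambda>t. cis (y * t) * p t)) \<le>
        norm (p 1) / y + norm (p 0) / y + C / y * (1 - 0)"
      unfolding eq by (rule order_trans[OF T]) (intro add_mono I N[THEN eq_refl])
    then show ?thesis by (simp add: D_def add_divide_distrib)
  qed
  have close: "norm (integral {0..1} (\<lambda>t. cis (y * t) * G t) -
      integral {0..1} (\<lambda>t. cis (y * t) * p t)) \<le> e / 2" for y
  proof -
    have "integral {0..1} (\<lambda>t. cis (y * t) * G t) - integral {0..1} (\<lambda>t. cis (y * t) * p t) =
        integral {0..1} (\<lambda>t. cis (y * t) * (G t - p t))"
      by (subst integral_diff [symmetric])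
         (auto intro!: integrable_continuous_interval continuous_intros cont assms simp: algebra_simps)
    moreover have "norm (integral {0..1} (\<lambda>t. cis (y * t) * (G t - p t))) \<le> e / 2 * (1 - 0)"
      using p(2) by (intro integral_bound)
        (auto intro!: continuous_intros cont assms less_imp_le simp: norm_mult)
    ultimately show ?thesis by simp
  qed
  have "((\<lambda>y. D / y) \<longlongrightarrow> 0) at_top"
    by (intro tendsto_divide_0[OF tendsto_const] filterlim_at_top_imp_at_infinity filterlim_ident)
  then have "eventually (\<lambda>y. D / y < e / 2) at_top"
    using e by (intro order_tendstoD(2)) auto
  then show "eventually (\<lambda>y. dist (integral {0..1} (\<lambda>t. cis (y * t) * G t)) 0 < e) at_top"
    using eventually_gt_at_top[of 0]
  proof eventually_elim
    case (elim y)
    then show ?case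
      using norm_triangle_sub[of "integral {0..1} (\<lambda>t. cis (y * t) * G t)"
          "integral {0..1} (\<lambda>t. cis (y * t) * p t)"] bound[of y] close[of y]
      unfolding dist_norm diff_zero by linarith
  qed
qed

text \<open>The factor y sinc(y t) is sin(y t) / t with its value at t = 0 filled in. Writing the
  kernel as 1 + t h(t) with h continuous splits the integral into Si(y), which tends to pi/2, and an
  integral of h(t) sin(y t), which tends to 0 by the Riemann-Lebesgue lemma.\<close>

lemma selberg_kernel_Dirichlet_limit:
  "((\<lambda>y. integral {0..1} (\<lambda>t. selberg_kernel t * (y * sinc (y * t)))) \<longlongrightarrow> pi / 2) at_top"
proof -
  define h where "h t = sinc (2 * pi * t) - 1" for t
  have conth: "continuous_on {0..1} h"
    unfolding h_def by (intro continuous_intros)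
  have eq: "selberg_kernel t * (y * sinc (y * t)) = y * sinc (y * t) + Im (cis (y * t) * of_real (h t))"
    if "y > 0" for t y
    using that by (auto simp: selberg_kernel_def h_def field_simps)
  have Si0: "Si 0 = 0"
    by (simp add: Si_def zero_ereal_def[symmetric])
  have Si: "((\<lambda>t. y * sinc (y * t)) has_integral Si y) {0..1}" for y
  proof -
    have "((\<lambda>t. Si (y * t)) has_real_derivative sinc (y * t) * y) (at t within {0..1})" for t
      by (rule DERIV_chain2[of Si, OF DERIV_Si]) (auto intro!: derivative_eq_intros)
    then have "((\<lambda>t. sinc (y * t) * y) has_integral (Si (y * 1) - Si (y * 0))) {0..1}"
      by (intro fundamental_theorem_of_calculus)
         (auto simp: has_real_derivative_iff_has_vector_derivative)
    then show ?thesis by (simp add: mult.commute Si0)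
  qed
  have int: "(\<lambda>t. cis (y * t) * of_real (h t)) integrable_on {0..1}" for y
    by (intro integrable_continuous_interval continuous_intros continuous_on_of_real conth)
  have "integral {0..1} (\<lambda>t. selberg_kernel t * (y * sinc (y * t))) =
      Si y + Im (integral {0..1} (\<lambda>t. cis (y * t) * of_real (h t)))" if "y > 0" for y
  proof -
    have "((\<lambda>t. y * sinc (y * t) + Im (cis (y * t) * of_real (h t))) has_integral
        (Si y + Im (integral {0..1} (\<lambda>t. cis (y * t) * of_real (h t))))) {0..1}"
      by (intro has_integral_add Si has_integral_Im integrable_integral int)
    then show ?thesis unfolding eq[OF that] by (rule integral_unique)
  qed
  then have ev: "eventually (\<lambda>y. Si y + Im (integral {0..1} (\<lambda>t. cis (y * t) * of_real (h t))) =
      integral {0..1} (\<lambda>t. selberg_kernel t * (y * sinc (y * t)))) at_top"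
    by (intro eventually_mono[OF eventually_gt_at_top[of 0]]) (rule sym)
  have "((\<lambda>y. Si y + Im (integral {0..1} (\<lambda>t. cis (y * t) * of_real (h t)))) \<longlongrightarrow> pi / 2 + Im 0) at_top"
    by (intro tendsto_intros Si_at_top Riemann_Lebesgue_continuous continuous_on_of_real conth)
  from Lim_transform_eventually[OF this ev] show ?thesis by simp
qed

section \<open>The zeta function and the Dirichlet series of the von Mangoldt function\<close>

(* With m = n + 1, this is s - 1 times the difference of m^(-s) and the integral of x^(-s) over
   [m, m + 1], so that zeta1 s = (s - 1) zeta(s), without a division by zero at s = 1. *)
definition zeta1_term :: "nat \<Rightarrow> complex \<Rightarrow> complex" where
  "zeta1_term n s = (s - 1) * of_nat (Suc n) powr (-s)
     + of_nat (Suc (Suc n)) powr (1 - s) - of_nat (Suc n) powr (1 - s)"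

definition zeta1 :: "complex \<Rightarrow> complex" where
  "zeta1 s = 1 + (\<Sum>n. zeta1_term n s)"

(* The summand with n = 0 vanishes, as 0 powr s = 0. *)
definition mangoldt_series :: "complex \<Rightarrow> complex" where
  "mangoldt_series s = (\<Sum>n. mangoldt n * of_nat n powr (-s))"

section \<open>Continuation of (s - 1) zeta(s) to Re s > 0\<close>

lemma norm_nat_powr: "norm (of_nat n powr s :: complex) = real n powr Re s"
  by (simp add: norm_powr_real_powr)

text \<open>The offset \<open>a\<close> covers both kinds of power in \<open>zeta1_term\<close>: a =
  0 and a = 1.\<close>

lemma nat_powr_has_derivative:
  assumes "n > 0"
  shows "((\<lambda>s. of_nat n powr (a - s)) has_field_derivative
           - (of_real (ln (real n)) * of_nat n powr (a - s))) (at (s :: complex))"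
proof -
  have "((\<lambda>s. a - s) has_field_derivative -1) (at s)"
    by (auto intro!: derivative_eq_intros)
  from DERIV_chain2[OF has_field_derivative_powr_right[of "of_nat n" "a - s"] this]
  show ?thesis using assms by (simp add: Ln_of_nat)
qed

text \<open>With m = n + 1, the term is the first-order Taylor remainder of z powr (1 - s) from m to
  m + 1. It is therefore controlled by the second derivative s (s - 1) z powr (-s - 1), which decays
  fast enough to be summed for all Re s > 0.\<close>

lemma norm_zeta1_term_le:
  assumes "Re s > 0"
  shows "norm (zeta1_term n s) \<le> norm s * norm (s - 1) * real (Suc n) powr (-Re s - 1)"
proof -
  define m where "m = Suc n"
  have m: "m > 0" by (simp add: m_def)
  define S where "S = closed_segment (complex_of_real (real m)) (of_real (real m + 1))"
  define f :: "nat \<Rightarrow> complex \<Rightarrow> complex" where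
    "f i = (\<lambda>z. if i = 0 then z powr (1 - s) else if i = 1 then (1 - s) * z powr (-s)
            else (1 - s) * (-s * z powr (-s - 1)))" for i
  have S: "\<exists>r. z = of_real r \<and> r \<ge> real m" if "z \<in> S" for z
    using that unfolding S_def closed_segment_of_real by (auto simp: closed_segment_eq_real_ivl)
  have ends: "of_nat m \<in> S" "of_nat m + 1 \<in> S"
    by (simp_all add: S_def)
  have "norm (f 0 (of_nat m + 1) - (\<Sum>i\<le>1. f i (of_nat m) * (of_nat m + 1 - of_nat m) ^ i / fact i))
     \<le> norm s * norm (s - 1) * real m powr (-Re s - 1) * norm (of_nat m + 1 - of_nat m :: complex) ^ Suc 1 / fact 1"
  proof (rule field_Taylor[where S = S])
    show "convex S" by (simp add: S_def)
    show "(f i has_field_derivative f (Suc i) z) (at z within S)" if "z \<in> S" "i \<le> 1" for i z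
    proof -
      have z: "z \<notin> \<real>\<^sub>\<le>\<^sub>0"
        using S[OF that(1)] m by (auto simp: complex_nonpos_Reals_iff)
      from that(2) consider "i = 0" | "i = 1" by linarith
      then show ?thesis
      proof cases
        case 1
        then show ?thesis
          using has_field_derivative_powr[OF z, of "1 - s"]
          by (auto simp: f_def intro: has_field_derivative_at_within)
      next
        case 2
        then show ?thesis
          using DERIV_cmult[OF has_field_derivative_powr[OF z, of "-s"], of "1 - s"]
          by (auto simp: f_def intro: has_field_derivative_at_within)
      qed
    qed
    show "norm (f (Suc 1) z) \<le> norm s * norm (s - 1) * real m powr (-Re s - 1)" if zS: "z \<in> S" for z
    proof -
      obtain r where r: "z = of_real r" "r \<ge> real m" using S[OF zS] by blast
      have "r powr (-Re s - 1) \<le> real m powr (-Re s - 1)"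
        using r m assms by (intro powr_mono2') auto
      then have "norm s * norm (s - 1) * r powr (-Re s - 1) \<le> norm s * norm (s - 1) * real m powr (-Re s - 1)"
        by (intro mult_left_mono) auto
      then show ?thesis
        using r m by (simp add: f_def norm_mult norm_powr_real_powr norm_minus_commute mult_ac)
    qed
  qed (use ends in auto)
  moreover have "f 0 (of_nat m + 1) - (\<Sum>i\<le>1. f i (of_nat m) * (of_nat m + 1 - of_nat m) ^ i / fact i)
      = zeta1_term n s"
    by (simp add: f_def zeta1_term_def m_def algebra_simps)
  ultimately show ?thesis by (simp add: m_def)
qed

lemma summable_nat_powr: "x > 1 \<Longrightarrow> summable (\<lambda>n. real n powr - x)"
  by (simp add: summable_real_powr_iff)

lemma zeta1_holomorphic: "zeta1 holomorphic_on {s. Re s > 0}"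
proof -
  define S where "S = {s. Re s > 0}"
  have op: "open S" unfolding S_def by (simp add: open_halfspace_Re_gt)
  define f' where "f' n = deriv (zeta1_term n)" for n
  have der: "(zeta1_term n has_field_derivative f' n s) (at s)" for n s
  proof -
    have "zeta1_term n field_differentiable (at s)"
      unfolding zeta1_term_def
      using nat_powr_has_derivative[of "Suc n" 0 s] nat_powr_has_derivative[of "Suc n" 1 s]
        nat_powr_has_derivative[of "Suc (Suc n)" 1 s]
      by (intro derivative_intros) (auto simp: field_differentiable_def simp del: of_nat_Suc)
    then show ?thesis unfolding f'_def by (simp add: DERIV_deriv_iff_field_differentiable)
  qed
  have "\<exists>g g'. \<forall>s\<in>S. (\<lambda>n. zeta1_term n s) sums g s \<and> (\<lambda>n. f' n s) sums g' s
      \<and> (g has_field_derivative g' s) (at s)"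
  proof (rule series_and_derivative_comparison_local[OF op der])
    fix s0 assume "s0 \<in> S"
    \<comment> \<open>On the ball of this radius Re s >= d, so the exponent -d - 1 is below -1
      uniformly.\<close>
    define d where "d = Re s0 / 2"
    have d: "d > 0" using \<open>s0 \<in> S\<close> by (simp add: S_def d_def)
    define C where "C = (norm s0 + d) * (norm s0 + d + 1)"
    have "norm (zeta1_term n s) \<le> C * real (Suc n) powr (-d - 1)" if s: "s \<in> ball s0 d \<inter> S" for n s
    proof -
      have "norm (s - s0) < d" using s by (simp add: dist_norm norm_minus_commute)
      then have 1: "norm s \<le> norm s0 + d" "Re s \<ge> d"
        using norm_triangle_sub[of s s0] complex_Re_le_cmod[of "s0 - s"]
        by (auto simp: d_def norm_minus_commute)
      then have 2: "norm (s - 1) \<le> norm s0 + d + 1"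
        using norm_triangle_ineq4[of s 1] by simp
      have "norm (zeta1_term n s) \<le> norm s * norm (s - 1) * real (Suc n) powr (-Re s - 1)"
        using s by (intro norm_zeta1_term_le) (simp add: S_def)
      also have "\<dots> \<le> (norm s0 + d) * (norm s0 + d + 1) * real (Suc n) powr (-d - 1)"
        using 1 2 d by (intro mult_mono powr_mono) auto
      finally show ?thesis by (simp add: C_def)
    qed
    moreover have "summable (\<lambda>n. C * real (Suc n) powr (-d - 1))"
      using d by (intro summable_mult) (subst summable_Suc_iff, simp add: summable_real_powr_iff)
    ultimately show "\<exists>d h. 0 < d \<and> summable h \<and>
        (\<forall>\<^sub>F n in sequentially. \<forall>s\<in>ball s0 d \<inter> S. norm (zeta1_term n s) \<le> h n)"
      using d by (intro exI[of _ d] exI[of _ "\<lambda>n. C * real (Suc n) powr (-d - 1)"]) auto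
  qed
  then obtain g g' where g: "\<And>s. s \<in> S \<Longrightarrow> (\<lambda>n. zeta1_term n s) sums g s"
    "\<And>s. s \<in> S \<Longrightarrow> (g has_field_derivative g' s) (at s)" by blast
  have "(\<lambda>s. 1 + g s) holomorphic_on S"
    using g(2) op by (intro holomorphic_intros) (auto simp: holomorphic_on_open)
  also have "?this \<longleftrightarrow> zeta1 holomorphic_on S"
    using g(1) by (intro holomorphic_cong) (auto simp: zeta1_def sums_iff)
  finally show ?thesis by (simp add: S_def)
qed

text \<open>Every term vanishes at s = 1; the value is the residue of zeta there. It also shows that
  \<open>zeta1\<close> is not identically zero, so that its zeros have finite order.\<close>

lemma zeta1_1: "zeta1 1 = 1"
  by (simp add: zeta1_def zeta1_term_def del: of_nat_Suc)

lemma zeta1_sums: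
  assumes "Re s > 0"
  shows "(\<lambda>n. zeta1_term n s) sums (zeta1 s - 1)"
proof -
  have "summable (\<lambda>n. norm s * norm (s - 1) * real (Suc n) powr (-Re s - 1))"
    using assms by (intro summable_mult) (subst summable_Suc_iff, simp add: summable_real_powr_iff)
  then have "summable (\<lambda>n. zeta1_term n s)"
    by (rule summable_comparison_test') (use norm_zeta1_term_le[OF assms] in auto)
  then show ?thesis by (simp add: zeta1_def summable_sums)
qed

lemma summable_norm_nat_powr: "Re s > 1 \<Longrightarrow> summable (\<lambda>n. norm (of_nat n powr (-s) :: complex))"
  using summable_nat_powr[of "Re s"] by (simp add: norm_nat_powr)

text \<open>For Re s > 1 the differences of the powers with exponent 1 - s telescope to -1, which
  cancels the leading 1 in \<open>zeta1\<close>.\<close>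

lemma zeta1_eq:
  assumes "Re s > 1"
  shows "zeta1 s = (s - 1) * (\<Sum>n. of_nat n powr (-s))"
proof -
  have "(\<lambda>n. of_nat n powr (-s) :: complex) sums (\<Sum>n. of_nat n powr (-s))"
    using summable_norm_nat_powr[OF assms] by (simp add: summable_norm_cancel summable_sums)
  then have "(\<lambda>n. of_nat (Suc n) powr (-s) :: complex) sums (\<Sum>n. of_nat n powr (-s))"
    by (subst sums_Suc_iff) simp
  then have 1: "(\<lambda>n. (s - 1) * of_nat (Suc n) powr (-s)) sums ((s - 1) * (\<Sum>n. of_nat n powr (-s)))"
    by (rule sums_mult)
  have "(\<lambda>n. of_nat n powr (1 - s) :: complex) \<longlonglongrightarrow> 0"
    using assms by (intro tendsto_neg_powr_complex_of_nat filterlim_ident) auto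
  then have "(\<lambda>n. of_nat (Suc n) powr (1 - s) :: complex) \<longlonglongrightarrow> 0"
    by (rule LIMSEQ_Suc)
  from sums_add[OF 1 telescope_sums[OF this]] have "(\<lambda>n. zeta1_term n s) sums
      ((s - 1) * (\<Sum>n. of_nat n powr (-s)) - 1)"
    by (simp add: zeta1_term_def algebra_simps)
  with zeta1_sums[of s] assms show ?thesis by (auto dest: sums_unique2)
qed

section \<open>The Dirichlet series of Lambda and the logarithmic derivative of zeta\<close>

lemma summable_ln_powr:
  assumes "x > 1"
  shows "summable (\<lambda>n. ln (real n) * real n powr - x)"
proof (rule summable_comparison_test')
  \<comment> \<open>The logarithm is absorbed into n powr a; half of the excess of x over 1 still
    leaves x - a > 1.\<close>
  define a where "a = (x - 1) / 2"
  have a: "a > 0" "x - a > 1" using assms by (auto simp: a_def field_simps)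
  show "summable (\<lambda>n. 1 / a * real n powr - (x - a))"
    by (intro summable_mult summable_nat_powr a)
  show "norm (ln (real n) * real n powr - x) \<le> 1 / a * real n powr - (x - a)" if "n \<ge> 1" for n
  proof -
    have "ln (real n) \<le> real n powr a / a"
      using that a by (intro ln_powr_bound) auto
    then have "ln (real n) * real n powr - x \<le> real n powr a / a * real n powr - x"
      by (intro mult_right_mono) auto
    also have "\<dots> = 1 / a * real n powr - (x - a)"
      by (simp add: powr_add [symmetric])
    finally show ?thesis using that by simp
  qed
qed

lemma mangoldt_le_ln: "mangoldt n \<le> ln (real n)"
  by (cases "n = 0") (auto simp: mangoldt_le)

lemma summable_mangoldt_powr:
  assumes "x > 1"
  shows "summable (\<lambda>n. mangoldt n * real n powr - x)"
  by (rule summable_comparison_test'[OF summable_ln_powr[OF assms], of 0])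
     (auto simp: abs_mult mangoldt_nonneg mangoldt_le_ln mult_right_mono)

lemma summable_norm_mangoldt_series:
  assumes "Re s > 1"
  shows "summable (\<lambda>n. norm (mangoldt n * of_nat n powr (-s) :: complex))"
  using summable_mangoldt_powr[OF assms] by (simp add: norm_mult norm_nat_powr)

lemma mangoldt_series_sums:
  "Re s > 1 \<Longrightarrow> (\<lambda>n. mangoldt n * of_nat n powr (-s)) sums mangoldt_series s"
  unfolding mangoldt_series_def
  by (rule summable_sums[OF summable_norm_cancel[OF summable_norm_mangoldt_series]])

lemma zeta_series_has_derivative:
  assumes "Re s > 1"
  shows "((\<lambda>s. \<Sum>n. of_nat n powr (-s)) has_field_derivative
           - (\<Sum>n. of_real (ln (real n)) * of_nat n powr (-s))) (at (s :: complex))"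
proof -
  define S where "S = {s. Re s > 1}"
  have op: "open S" unfolding S_def by (simp add: open_halfspace_Re_gt)
  have der: "((\<lambda>s. of_nat n powr (-s)) has_field_derivative
      - (of_real (ln (real n)) * of_nat n powr (-s))) (at s)" for n and s :: complex
  proof (cases "n = 0")
    case False
    then show ?thesis
      using nat_powr_has_derivative[of n 0 s] by simp
  qed auto
  have "\<exists>g g'. \<forall>s\<in>S. (\<lambda>n. of_nat n powr (-s)) sums g s \<and>
      (\<lambda>n. - (of_real (ln (real n)) * of_nat n powr (-s))) sums g' s
      \<and> (g has_field_derivative g' s) (at s)"
  proof (rule series_and_derivative_comparison_local[OF op der])
    fix s0 assume "s0 \<in> S"
    define d where "d = (Re s0 - 1) / 2"
    have d: "d > 0" using \<open>s0 \<in> S\<close> by (simp add: S_def d_def)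
    have "norm (of_nat n powr (-s) :: complex) \<le> real n powr - (1 + d)" if s: "s \<in> ball s0 d \<inter> S" for n s
    proof (cases "n = 0")
      case False
      have "norm (s0 - s) < d" using s by (simp add: dist_norm)
      then have "Re s \<ge> 1 + d"
        using complex_Re_le_cmod[of "s0 - s"] by (simp add: d_def field_simps)
      then show ?thesis
        using False unfolding norm_nat_powr by (intro powr_mono) auto
    qed auto
    then show "\<exists>d h. 0 < d \<and> summable h \<and>
        (\<forall>\<^sub>F n in sequentially. \<forall>s\<in>ball s0 d \<inter> S. norm (of_nat n powr (-s) :: complex) \<le> h n)"
      using d by (intro exI[of _ d] exI[of _ "\<lambda>n. real n powr - (1 + d)"])
        (auto simp: summable_real_powr_iff)
  qed
  then obtain g g' where g: "\<And>s. s \<in> S \<Longrightarrow> (\<lambda>n. of_nat n powr (-s)) sums g s"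
    "\<And>s. s \<in> S \<Longrightarrow> (\<lambda>n. - (of_real (ln (real n)) * of_nat n powr (-s))) sums g' s"
    "\<And>s. s \<in> S \<Longrightarrow> (g has_field_derivative g' s) (at s)" by blast
  have s: "s \<in> S" using assms by (simp add: S_def)
  have "((\<lambda>s. \<Sum>n. of_nat n powr (-s)) has_field_derivative g' s) (at s)"
    using g(3)[OF s] by (rule has_field_derivative_transform_within_open[OF _ op s])
      (use g(1) in \<open>auto simp: sums_iff\<close>)
  moreover have "g' s = - (\<Sum>n. of_real (ln (real n)) * of_nat n powr (-s))"
    using sums_minus[OF g(2)[OF s]] by (simp add: sums_iff)
  ultimately show ?thesis by simp
qed

text \<open>The Dirichlet convolution of Lambda and 1 is ln. Absolute summability over all pairs (n,
  m) permits grouping them by their product.\<close>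

lemma mangoldt_series_mult_zeta:
  assumes "Re s > 1"
  shows "mangoldt_series s * (\<Sum>n. of_nat n powr (-s)) =
           (\<Sum>n. of_real (ln (real n)) * of_nat n powr (-s))"
proof -
  define a where "a n = (mangoldt n * of_nat n powr (-s) :: complex)" for n
  define b where "b n = (of_nat n powr (-s) :: complex)" for n :: nat
  define Z where "Z = (\<Sum>n. b n)"
  \<comment> \<open>Index 0 contributes nothing to the series, but it has to be removed before
    grouping: 0 has infinitely many divisors.\<close>
  have a: "(a has_sum mangoldt_series s) {1..}" "(\<lambda>n. norm (a n)) summable_on {1..}"
  proof -
    have "(a has_sum mangoldt_series s) UNIV"
      unfolding a_def
      by (rule norm_summable_imp_has_sum[OF summable_norm_mangoldt_series mangoldt_series_sums])
         (use assms in auto)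
    also have "?this \<longleftrightarrow> (a has_sum mangoldt_series s) {1..}"
      by (rule has_sum_cong_neutral) (auto simp: a_def not_le)
    finally show "(a has_sum mangoldt_series s) {1..}" .
    show "(\<lambda>n. norm (a n)) summable_on {1..}"
      using summable_norm_mangoldt_series[OF assms] unfolding a_def
      by (intro summable_on_subset_banach[OF norm_summable_imp_summable_on, of _ "{1..}"]) auto
  qed
  have b: "(b has_sum Z) {1..}" "(\<lambda>n. norm (b n)) summable_on {1..}"
  proof -
    have sm: "summable (\<lambda>n. norm (b n))"
      using summable_norm_nat_powr[OF assms] by (simp add: b_def)
    have "(b has_sum Z) UNIV"
      unfolding Z_def by (rule norm_summable_imp_has_sum[OF sm summable_sums[OF summable_norm_cancel[OF sm]]])
    also have "?this \<longleftrightarrow> (b has_sum Z) {1..}"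
      by (rule has_sum_cong_neutral) (auto simp: b_def not_le)
    finally show "(b has_sum Z) {1..}" .
    show "(\<lambda>n. norm (b n)) summable_on {1..}"
      using sm by (intro summable_on_subset_banach[OF norm_summable_imp_summable_on, of _ "{1..}"]) auto
  qed
  have "(\<lambda>p. norm (case p of (n, m) \<Rightarrow> a n * b m)) summable_on {1..} \<times> {1..}"
    unfolding Infinite_Sum.abs_summable_on_Sigma_iff
  proof (intro conjI ballI)
    show "(\<lambda>m. norm (case (n, m) of (n, m) \<Rightarrow> a n * b m)) summable_on {1..}" for n
      using b(2) by (simp add: norm_mult summable_on_cmult_right)
    have "(\<lambda>n. norm (a n) * infsum (\<lambda>m. norm (b m)) {1..}) summable_on {1..}"
      by (intro summable_on_cmult_left a)
    moreover have "norm (infsum (\<lambda>m. norm (b m)) {1..}) = infsum (\<lambda>m. norm (b m)) {1..}"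
      by (simp add: infsum_nonneg)
    ultimately show "(\<lambda>n. norm (infsum (\<lambda>m. norm (case (n, m) of (n, m) \<Rightarrow> a n * b m)) {1..})) summable_on {1..}"
      by (simp add: norm_mult infsum_cmult_right')
  qed
  then have "(\<lambda>(n, m). a n * b m) summable_on {1..} \<times> {1..}"
    by (rule Infinite_Sum.abs_summable_summable)
  then have "((\<lambda>(n, m). a n * b m) has_sum (mangoldt_series s * Z)) ({1..} \<times> {1..})"
  proof (rule has_sum_SigmaI[where g = "\<lambda>n. a n * Z", rotated 2])
    show "((\<lambda>m. case (n, m) of (n, m) \<Rightarrow> a n * b m) has_sum a n * Z) {1..}" for n
      using has_sum_cmult_right[OF b(1)] by simp
    show "((\<lambda>n. a n * Z) has_sum mangoldt_series s * Z) {1..}"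
      by (rule has_sum_cmult_left[OF a(1)])
  qed
  \<comment> \<open>The pair (n, m) becomes N = n m with the marked divisor d = n; the powers
    combine to N powr (-s).\<close>
  also have "?this \<longleftrightarrow> ((\<lambda>(N, d). mangoldt d * b N) has_sum (mangoldt_series s * Z))
      (SIGMA N:{1..}. {d. d dvd N})"
  proof (rule has_sum_reindex_bij_witness[where i = "\<lambda>(N, d). (d, N div d)" and j = "\<lambda>(n, m). (n * m, n)"])
    fix x :: "nat \<times> nat" assume "x \<in> {1..} \<times> {1..}"
    then show "(case case x of (n, m) \<Rightarrow> (n * m, n) of (N, d) \<Rightarrow> mangoldt d * b N)
        = (case x of (n, m) \<Rightarrow> a n * b m)"
      by (auto simp: a_def b_def powr_times_real)
  next
    fix y :: "nat \<times> nat" assume "y \<in> (SIGMA N:{1..}. {d. d dvd N})"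
    then obtain N d where "y = (N, d)" "N > 0" "d dvd N" by auto
    then have "d > 0" "N div d > 0"
      by (auto simp: dvd_pos_nat div_greater_zero_iff dvd_imp_le)
    then show "(case y of (N, d) \<Rightarrow> (d, N div d)) \<in> {1..} \<times> {1..}"
      using \<open>y = (N, d)\<close> by (simp add: Suc_le_eq)
  qed auto
  finally have "((\<lambda>N. (\<Sum>d | d dvd N. mangoldt d * b N)) has_sum (mangoldt_series s * Z)) {1..}"
    by (rule has_sum_SigmaD) (auto intro!: has_sum_finiteI)
  also have "?this \<longleftrightarrow> ((\<lambda>N. of_real (ln (real N)) * b N) has_sum (mangoldt_series s * Z)) {1..}"
    by (intro has_sum_cong) (auto simp: sum_distrib_right [symmetric] mangoldt_sum)
  also have "\<dots> \<longleftrightarrow> ((\<lambda>N. of_real (ln (real N)) * b N) has_sum (mangoldt_series s * Z)) UNIV"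
    by (rule has_sum_cong_neutral) (auto simp: b_def not_le)
  finally show ?thesis
    by (auto dest!: has_sum_imp_sums simp: sums_iff b_def Z_def)
qed

text \<open>This comes from differentiating the product (s - 1) zeta(s). It is stated without
  dividing by \<open>zeta1 s\<close>, because non-vanishing for Re s > 1 is proved afterwards, from
  this identity.\<close>

lemma mangoldt_series_mult_zeta1:
  assumes "Re s > 1"
  shows "mangoldt_series s * zeta1 s = zeta1 s / (s - 1) - deriv zeta1 s"
proof -
  define Z where "Z s = (\<Sum>n. of_nat n powr (-s) :: complex)" for s
  define L where "L = (\<Sum>n. of_real (ln (real n)) * of_nat n powr (-s) :: complex)"
  have s: "s \<noteq> 1" using assms by auto
  have "((\<lambda>s. (s - 1) * Z s) has_field_derivative (1 * Z s + - L * (s - 1))) (at s)"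
    unfolding Z_def L_def
    by (rule DERIV_mult[OF _ zeta_series_has_derivative[OF assms]]) (auto intro!: derivative_eq_intros)
  then have "(zeta1 has_field_derivative (1 * Z s + - L * (s - 1))) (at s)"
    by (rule has_field_derivative_transform_within_open[OF _ open_halfspace_Re_gt[of 1]])
       (use assms in \<open>auto simp: zeta1_eq Z_def\<close>)
  then have d: "deriv zeta1 s = Z s - L * (s - 1)"
    by (simp add: DERIV_imp_deriv)
  have L: "mangoldt_series s * Z s = L"
    using mangoldt_series_mult_zeta[OF assms] by (simp add: Z_def L_def)
  have z: "zeta1 s = (s - 1) * Z s"
    using zeta1_eq[OF assms] by (simp add: Z_def)
  have "mangoldt_series s * zeta1 s = L * (s - 1)" "zeta1 s / (s - 1) = Z s"
    using s by (simp_all add: z flip: L)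
  then show ?thesis
    unfolding d by simp
qed

section \<open>Non-vanishing on the line Re s = 1\<close>

text \<open>The number \<open>n\<close> is the order of the zero at \<xi>: if f(w) = (w - \<xi>)^n
  g(w) with g zero-free, then f'/f = n / (w - \<xi>) + g'/g. The point \<open>c\<close> excludes the
  zero function, so the order is finite and zeros are isolated.\<close>

lemma logarithmic_derivative_at_zero:
  assumes f: "f holomorphic_on S" "open S" "connected S" and "\<xi> \<in> S" "c \<in> S" "f c \<noteq> 0"
  obtains n :: nat where "n = 0 \<longleftrightarrow> f \<xi> \<noteq> 0"
    "((\<lambda>w. (w - \<xi>) * (deriv f w / f w)) \<longlongrightarrow> of_nat n) (at \<xi>)"
    "eventually (\<lambda>w. f w \<noteq> 0) (at \<xi>)"
proof (cases "f \<xi> = 0")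
  case True
  have nonconst: "\<not> f constant_on S"
    using True \<open>\<xi> \<in> S\<close> \<open>c \<in> S\<close> \<open>f c \<noteq> 0\<close> by (metis constant_on_def)
  show thesis
  proof (rule holomorphic_factor_zero_nonconstant[OF f \<open>\<xi> \<in> S\<close> True nonconst])
    fix g r and n :: nat
    assume g: "0 < n" "0 < r" "ball \<xi> r \<subseteq> S" "g holomorphic_on ball \<xi> r"
      "\<And>w. w \<in> ball \<xi> r \<Longrightarrow> f w = (w - \<xi>) ^ n * g w"
      "\<And>w. w \<in> ball \<xi> r \<Longrightarrow> g w \<noteq> 0"
    have ev: "eventually (\<lambda>w. w \<in> ball \<xi> r \<and> w \<noteq> \<xi>) (at \<xi>)"
      using g(2) by (auto simp: eventually_at dist_commute intro!: exI[of _ r])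
    have eq: "of_nat n + (w - \<xi>) * (deriv g w / g w) = (w - \<xi>) * (deriv f w / f w)"
      if "w \<in> ball \<xi> r" "w \<noteq> \<xi>" for w
    proof -
      have "(g has_field_derivative deriv g w) (at w)"
        using g(4) that by (intro holomorphic_derivI[of _ "ball \<xi> r"]) auto
      then have "((\<lambda>w. (w - \<xi>) ^ n * g w) has_field_derivative
          (of_nat n * (w - \<xi>) ^ (n - 1) * g w + deriv g w * (w - \<xi>) ^ n)) (at w)"
        by (auto intro!: derivative_eq_intros)
      then have "(f has_field_derivative
          (of_nat n * (w - \<xi>) ^ (n - 1) * g w + deriv g w * (w - \<xi>) ^ n)) (at w)"
        by (rule has_field_derivative_transform_within_open[where S = "ball \<xi> r"])
           (use that g(5) in auto)
      then have d: "deriv f w = of_nat n * (w - \<xi>) ^ (n - 1) * g w + deriv g w * (w - \<xi>) ^ n"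
        by (rule DERIV_imp_deriv)
      have p: "(w - \<xi>) ^ n = (w - \<xi>) * (w - \<xi>) ^ (n - 1)"
        using g(1) by (cases n) auto
      show ?thesis
        using that g(6)[of w] unfolding d g(5)[OF that(1)] p by (simp add: field_simps)
    qed
    have cont: "isCont (\<lambda>w. deriv g w / g w) \<xi>"
      using g by (intro continuous_divide analytic_at_imp_isCont holomorphic_on_imp_analytic_at[of _ "ball \<xi> r"] holomorphic_deriv) auto
    show thesis
    proof
      show "n = 0 \<longleftrightarrow> f \<xi> \<noteq> 0" using True g(1) by simp
      show "eventually (\<lambda>w. f w \<noteq> 0) (at \<xi>)"
        using ev by eventually_elim (use g(5,6) in auto)
      have "((\<lambda>w. of_nat n + (w - \<xi>) * (deriv g w / g w)) \<longlongrightarrow> of_nat n + (\<xi> - \<xi>) * (deriv g \<xi> / g \<xi>)) (at \<xi>)"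
        by (intro tendsto_add tendsto_mult tendsto_diff tendsto_const tendsto_ident_at cont[unfolded isCont_def])
      then have "((\<lambda>w. of_nat n + (w - \<xi>) * (deriv g w / g w)) \<longlongrightarrow> of_nat n) (at \<xi>)"
        by simp
      then show "((\<lambda>w. (w - \<xi>) * (deriv f w / f w)) \<longlongrightarrow> of_nat n) (at \<xi>)"
        by (rule Lim_transform_eventually) (use ev in eventually_elim, use eq in auto)
    qed
  qed
next
  case False
  have cf: "isCont f \<xi>" "isCont (deriv f) \<xi>"
    using assms by (auto intro!: analytic_at_imp_isCont holomorphic_on_imp_analytic_at[of _ S] holomorphic_deriv)
  show thesis
  proof
    show "(0::nat) = 0 \<longleftrightarrow> f \<xi> \<noteq> 0" using False by simp
    show "eventually (\<lambda>w. f w \<noteq> 0) (at \<xi>)"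
      using cf(1) False unfolding isCont_def by (rule tendsto_imp_eventually_ne)
    have "((\<lambda>w. (w - \<xi>) * (deriv f w / f w)) \<longlongrightarrow> (\<xi> - \<xi>) * (deriv f \<xi> / f \<xi>)) (at \<xi>)"
      using cf False unfolding isCont_def by (intro tendsto_intros)
    then show "((\<lambda>w. (w - \<xi>) * (deriv f w / f w)) \<longlongrightarrow> of_nat 0) (at \<xi>)"
      by simp
  qed
qed

lemma zeta1_logarithmic_derivative_limit:
  assumes "Re \<xi> > 0"
  shows "\<exists>n :: nat. (n = 0 \<longleftrightarrow> zeta1 \<xi> \<noteq> 0) \<and>
    ((\<lambda>w. (w - \<xi>) * (deriv zeta1 w / zeta1 w)) \<longlongrightarrow> of_nat n) (at \<xi>) \<and>
    eventually (\<lambda>w. zeta1 w \<noteq> 0) (at \<xi>)"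
proof (rule logarithmic_derivative_at_zero[OF zeta1_holomorphic open_halfspace_Re_gt
        convex_connected[OF convex_halfspace_Re_gt], of \<xi> 1])
  fix n :: nat
  assume "n = 0 \<longleftrightarrow> zeta1 \<xi> \<noteq> 0" "eventually (\<lambda>w. zeta1 w \<noteq> 0) (at \<xi>)"
    "((\<lambda>w. (w - \<xi>) * (deriv zeta1 w / zeta1 w)) \<longlongrightarrow> of_nat n) (at \<xi>)"
  then show ?thesis by (intro exI[of _ n] conjI)
qed (use assms zeta1_1 in auto)

lemma mangoldt_series_eq:
  assumes "Re s > 1" "zeta1 s \<noteq> 0"
  shows "mangoldt_series s = 1 / (s - 1) - deriv zeta1 s / zeta1 s"
proof -
  have "mangoldt_series s = mangoldt_series s * zeta1 s / zeta1 s"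
    using assms(2) by simp
  also have "\<dots> = 1 / (s - 1) - deriv zeta1 s / zeta1 s"
    using assms(2) by (simp add: mangoldt_series_mult_zeta1[OF assms(1)] diff_divide_distrib)
  finally show ?thesis .
qed

lemma norm_mangoldt_series_le:
  assumes "c > 1" "Re w \<ge> c"
  shows "norm (mangoldt_series w) \<le> (\<Sum>n. mangoldt n * real n powr - c)"
  unfolding mangoldt_series_def
proof (rule norm_suminf_le)
  show "norm (mangoldt n * of_nat n powr (- w) :: complex) \<le> mangoldt n * real n powr - c" for n
  proof (cases "n = 0")
    case False
    then show ?thesis
      unfolding norm_mult norm_nat_powr norm_mangoldt
      using assms by (intro mult_left_mono mangoldt_nonneg powr_mono) auto
  qed auto
  show "summable (\<lambda>n. mangoldt n * real n powr - c)"
    by (rule summable_mangoldt_powr[OF assms(1)])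
qed

text \<open>A zero of order n would make the series of Lambda behave like -n / (w - \<xi>) near
  \<xi>. But the series is bounded on Re w >= c for c strictly between 1 and Re \<xi>, so n =
  0.\<close>

lemma zeta1_nonzero_right:
  assumes "Re \<xi> > 1"
  shows "zeta1 \<xi> \<noteq> 0"
proof -
  obtain n :: nat where n: "n = 0 \<longleftrightarrow> zeta1 \<xi> \<noteq> 0"
    "((\<lambda>w. (w - \<xi>) * (deriv zeta1 w / zeta1 w)) \<longlongrightarrow> of_nat n) (at \<xi>)"
    "eventually (\<lambda>w. zeta1 w \<noteq> 0) (at \<xi>)"
    using zeta1_logarithmic_derivative_limit[of \<xi>] assms by fastforce
  define c where "c = (1 + Re \<xi>) / 2"
  have c: "c > 1" "c < Re \<xi>" using assms by (auto simp: c_def)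
  have ev: "eventually (\<lambda>w. Re w > c) (at \<xi>)"
    using c(2) by (intro order_tendstoD(1)[of Re "Re \<xi>"] tendsto_intros)
  have \<xi>: "\<xi> \<noteq> 1" using assms by auto
  have "((\<lambda>w. (w - \<xi>) / (w - 1) - (w - \<xi>) * (deriv zeta1 w / zeta1 w)) \<longlongrightarrow>
      (\<xi> - \<xi>) / (\<xi> - 1) - of_nat n) (at \<xi>)"
    using \<xi> by (intro tendsto_intros n) auto
  then have lim: "((\<lambda>w. (w - \<xi>) * mangoldt_series w) \<longlongrightarrow> - of_nat n) (at \<xi>)"
    unfolding diff_self div_0 diff_0
  proof (rule Lim_transform_eventually)
    show "eventually (\<lambda>w. (w - \<xi>) / (w - 1) - (w - \<xi>) * (deriv zeta1 w / zeta1 w)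
        = (w - \<xi>) * mangoldt_series w) (at \<xi>)"
      using ev n(3)
    proof eventually_elim
      case (elim w)
      then show ?case using c(1) by (subst mangoldt_series_eq) (auto simp: right_diff_distrib)
    qed
  qed
  define C where "C = (\<Sum>n. mangoldt n * real n powr - c)"
  have "((\<lambda>w. (w - \<xi>) * mangoldt_series w) \<longlongrightarrow> 0) (at \<xi>)"
  proof (rule Lim_null_comparison)
    show "eventually (\<lambda>w. norm ((w - \<xi>) * mangoldt_series w) \<le> norm (w - \<xi>) * C) (at \<xi>)"
      using ev
    proof eventually_elim
      case (elim w)
      then show ?case
        using norm_mangoldt_series_le[OF c(1), of w] by (simp add: norm_mult C_def mult_left_mono)
    qed
    have "((\<lambda>w. norm (w - \<xi>) * C) \<longlongrightarrow> norm (\<xi> - \<xi>) * C) (at \<xi>)"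
      by (intro tendsto_intros)
    then show "((\<lambda>w. norm (w - \<xi>) * C) \<longlongrightarrow> 0) (at \<xi>)" by simp
  qed
  from tendsto_unique[OF _ lim this] n(1) show ?thesis by simp
qed

section \<open>Mertens' inequality and the approach to the line\<close>

lemma nat_powr_cis:
  "of_nat n powr - (of_real x + \<i> * of_real t) = of_real (real n powr - x) * cis (- (t * ln (real n)))"
proof (cases "n = 0")
  case False
  then show ?thesis
    by (simp add: powr_def cis_conv_exp exp_of_real [symmetric] flip: exp_add)
       (simp add: algebra_simps)
qed auto

lemma Re_mangoldt_series_sums:
  assumes "x > 1"
  shows "(\<lambda>n. mangoldt n * real n powr - x * cos (t * ln (real n))) sums
           Re (mangoldt_series (of_real x + \<i> * of_real t))"
  using sums_Re[OF mangoldt_series_sums[of "of_real x + \<i> * of_real t"]] assms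
  unfolding nat_powr_cis by (simp add: mult_ac)

text \<open>The coefficients of the series are nonnegative and 3 + 4 cos v + cos 2v = 2 (1 + cos
  v)^2.\<close>

lemma mangoldt_series_341:
  assumes "x > 1"
  shows "3 * Re (mangoldt_series (of_real x + \<i> * of_real 0))
       + 4 * Re (mangoldt_series (of_real x + \<i> * of_real t))
       + Re (mangoldt_series (of_real x + \<i> * of_real (2 * t))) \<ge> 0" (is "?S \<ge> 0")
proof -
  have "(\<lambda>n. 3 * (mangoldt n * real n powr - x * cos (0 * ln (real n)))
       + 4 * (mangoldt n * real n powr - x * cos (t * ln (real n)))
       + mangoldt n * real n powr - x * cos (2 * t * ln (real n))) sums ?S"
    by (intro sums_add sums_mult Re_mangoldt_series_sums assms)
  moreover have "3 * (mangoldt n * real n powr - x * cos (0 * ln (real n)))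
       + 4 * (mangoldt n * real n powr - x * cos (t * ln (real n)))
       + mangoldt n * real n powr - x * cos (2 * t * ln (real n)) \<ge> 0" for n
  proof -
    define u where "u = cos (t * ln (real n))"
    define w where "w = mangoldt n * real n powr - x"
    have "cos (2 * t * ln (real n)) = 2 * u\<^sup>2 - 1"
      using cos_double_cos[of "t * ln (real n)"] by (simp add: u_def mult.assoc)
    moreover have "3 * (w * 1) + 4 * (w * u) + w * (2 * u\<^sup>2 - 1) = w * (2 * (1 + u)\<^sup>2)"
      by (simp add: power2_eq_square algebra_simps)
    moreover have "w * (2 * (1 + u)\<^sup>2) \<ge> 0"
      by (simp add: w_def mangoldt_nonneg)
    ultimately show ?thesis
      by (simp only: w_def u_def mult_zero_left cos_zero)
  qed
  ultimately show ?thesis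
    by (rule sums_le[OF _ sums_zero, rotated])
qed

text \<open>The limit is minus the order of 1 + i t as a zero of \<open>zeta1\<close>, plus 1 from
  the pole 1 / (s - 1) when t = 0.\<close>

lemma mangoldt_series_limit:
  "\<exists>n :: nat. (n = 0 \<longleftrightarrow> zeta1 (1 + \<i> * of_real t) \<noteq> 0) \<and>
    ((\<lambda>h. h * Re (mangoldt_series (of_real (1 + h) + \<i> * of_real t))) \<longlongrightarrow>
       (if t = 0 then 1 else 0) - real n) (at_right 0)"
proof -
  define \<xi> where "\<xi> = 1 + \<i> * of_real t"
  have Re\<xi>: "Re \<xi> = 1" by (simp add: \<xi>_def)
  have "Re \<xi> > 0" by (simp add: Re\<xi>)
  from zeta1_logarithmic_derivative_limit[OF this]
  obtain n :: nat where n: "n = 0 \<longleftrightarrow> zeta1 \<xi> \<noteq> 0"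
    "((\<lambda>w. (w - \<xi>) * (deriv zeta1 w / zeta1 w)) \<longlongrightarrow> of_nat n) (at \<xi>)"
    by (elim exE conjE)
  have "((\<lambda>h. \<xi> + of_real h) \<longlongrightarrow> \<xi> + of_real 0) (at_right 0)"
    by (intro tendsto_intros)
  then have "filterlim (\<lambda>h. \<xi> + of_real h) (at \<xi>) (at_right 0)"
    unfolding filterlim_at
    by (auto intro: eventually_mono[OF eventually_at_right_less[of 0]])
  from filterlim_compose[OF n(2) this]
  have 1: "((\<lambda>h. of_real h * (deriv zeta1 (\<xi> + of_real h) / zeta1 (\<xi> + of_real h))) \<longlongrightarrow> of_nat n) (at_right 0)"
    by simp
  have 2: "((\<lambda>h. of_real h / (of_real h + \<i> * of_real t)) \<longlongrightarrow> (if t = 0 then 1 else 0)) (at_right 0)"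
  proof (cases "t = 0")
    case True
    have "eventually (\<lambda>h. of_real h / (of_real h + \<i> * of_real t) = (1 :: complex)) (at_right 0)"
      using eventually_at_right_less[of 0] by eventually_elim (simp add: True)
    then show ?thesis using True by (simp add: tendsto_eventually)
  next
    case False
    have "((\<lambda>h. of_real h / (of_real h + \<i> * of_real t)) \<longlongrightarrow> (of_real 0 / (of_real 0 + \<i> * of_real t) :: complex)) (at_right 0)"
      by (intro tendsto_intros) (use False in auto)
    then show ?thesis using False by simp
  qed
  have "((\<lambda>h. Re (of_real h / (of_real h + \<i> * of_real t) -
      of_real h * (deriv zeta1 (\<xi> + of_real h) / zeta1 (\<xi> + of_real h)))) \<longlongrightarrow>
      Re ((if t = 0 then 1 else 0) - of_nat n)) (at_right 0)"
    by (intro tendsto_Re tendsto_diff 1 2)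
  also have "Re ((if t = 0 then 1 else 0) - of_nat n) = (if t = 0 then 1 else 0) - real n"
    by simp
  finally have "((\<lambda>h. h * Re (mangoldt_series (of_real (1 + h) + \<i> * of_real t))) \<longlongrightarrow>
      (if t = 0 then 1 else 0) - real n) (at_right 0)"
  proof (rule Lim_transform_eventually)
    show "eventually (\<lambda>h. Re (of_real h / (of_real h + \<i> * of_real t) -
      of_real h * (deriv zeta1 (\<xi> + of_real h) / zeta1 (\<xi> + of_real h))) =
      h * Re (mangoldt_series (of_real (1 + h) + \<i> * of_real t))) (at_right 0)"
      using eventually_at_right_less[of 0]
    proof eventually_elim
      case (elim h)
      have eq: "of_real (1 + h) + \<i> * of_real t = \<xi> + of_real h"
        by (simp add: \<xi>_def)
      have "mangoldt_series (\<xi> + of_real h) = 1 / (of_real h + \<i> * of_real t) -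
          deriv zeta1 (\<xi> + of_real h) / zeta1 (\<xi> + of_real h)"
        using elim Re\<xi> by (subst mangoldt_series_eq) (auto intro!: zeta1_nonzero_right simp: \<xi>_def add_ac)
      then have "of_real h / (of_real h + \<i> * of_real t) -
          of_real h * (deriv zeta1 (\<xi> + of_real h) / zeta1 (\<xi> + of_real h)) = of_real h * mangoldt_series (\<xi> + of_real h)"
        by (simp add: right_diff_distrib)
      then show ?case unfolding eq by simp
    qed
  qed
  with n(1) show ?thesis unfolding \<xi>_def by (intro exI[of _ n] conjI)
qed

text \<open>Multiplying the 3-4-1 inequality by h and letting h tend to 0 gives 3 (1 - n0) - 4 n1 -
  n2 >= 0 for the orders at 1, 1 + i t and 1 + 2 i t. Hence 4 n1 <= 3, and the integer n1 is
  0.\<close>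

lemma zeta1_nonzero:
  assumes "Re s \<ge> 1"
  shows "zeta1 s \<noteq> 0"
proof (cases "Re s = 1 \<and> Im s \<noteq> 0")
  case False
  then consider "Re s > 1" | "s = 1"
    using assms by (cases "Re s = 1") (auto simp: complex_eq_iff)
  then show ?thesis
    by cases (auto simp: zeta1_nonzero_right zeta1_1)
next
  case True
  define t where "t = Im s"
  have s: "s = 1 + \<i> * of_real t" and t: "t \<noteq> 0"
    using True by (auto simp: t_def complex_eq_iff)
  let ?M = "\<lambda>t h. h * Re (mangoldt_series (of_real (1 + h) + \<i> * of_real t))"
  obtain n0 :: nat where n0: "(?M 0 \<longlongrightarrow> 1 - real n0) (at_right 0)"
    using mangoldt_series_limit[of 0] unfolding if_P[OF refl] by blast
  obtain n1 :: nat where n1: "(?M t \<longlongrightarrow> 0 - real n1) (at_right 0)" "n1 = 0 \<longleftrightarrow> zeta1 s \<noteq> 0"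
    using mangoldt_series_limit[of t] unfolding if_not_P[OF t] s by blast
  obtain n2 :: nat where n2: "(?M (2 * t) \<longlongrightarrow> 0 - real n2) (at_right 0)"
    using mangoldt_series_limit[of "2 * t"] t by (auto simp del: of_real_mult)
  have "((\<lambda>h. 3 * ?M 0 h + 4 * ?M t h + ?M (2 * t) h) \<longlongrightarrow>
      3 * (1 - real n0) + 4 * (0 - real n1) + (0 - real n2)) (at_right 0)"
    by (intro tendsto_intros n0 n1 n2)
  then have "3 * (1 - real n0) + 4 * (0 - real n1) + (0 - real n2) \<ge> 0"
  proof (rule tendsto_lowerbound)
    show "eventually (\<lambda>h. 0 \<le> 3 * ?M 0 h + 4 * ?M t h + ?M (2 * t) h) (at_right 0)"
      using eventually_at_right_less[of 0]
    proof eventually_elim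
      case (elim h)
      have "0 \<le> h * (3 * Re (mangoldt_series (of_real (1 + h) + \<i> * of_real 0))
       + 4 * Re (mangoldt_series (of_real (1 + h) + \<i> * of_real t))
       + Re (mangoldt_series (of_real (1 + h) + \<i> * of_real (2 * t))))"
        using elim by (intro mult_nonneg_nonneg mangoldt_series_341) auto
      then show ?case by (simp add: algebra_simps)
    qed
  qed auto
  then have "real n1 < 1" by simp
  then have "n1 = 0" by simp
  with n1(2) show ?thesis by simp
qed

section \<open>The smoothed sum over prime powers\<close>

text \<open>Only powers p^(j + 2) contribute. Since p^j >= 2^j, the sum is at most that of ln p /
  p^2 times the geometric series with sum 2.\<close>

lemma summable_mangoldt_nonprime:
  "summable (\<lambda>n. if prime n then 0 else mangoldt n / real n)"
proof -
  define q :: "nat \<Rightarrow> real" where "q n = (if prime n then 0 else mangoldt n / real n)" for n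
  define a :: "nat \<Rightarrow> real" where "a p = ln (real p) * real p powr - 2" for p
  have a: "summable a" "\<And>p. a p \<ge> 0"
  proof -
    show "summable a" using summable_ln_powr[of 2] by (simp add: a_def[abs_def])
    show "a p \<ge> 0" for p by (cases "p = 0") (auto simp: a_def)
  qed
  have q0: "q n \<ge> 0" for n by (simp add: q_def mangoldt_nonneg)
  have "(\<Sum>n<N. q n) \<le> suminf a * 2" for N
  proof -
    define P where "P = {p. prime p \<and> p < N} \<times> {..<N}"
    define h :: "nat \<times> nat \<Rightarrow> nat" where "h = (\<lambda>(p, j). p ^ (j + 2))"
    have fin: "finite P" by (simp add: P_def)
    have "(\<Sum>n<N. q n) = sum q {n\<in>{..<N}. q n \<noteq> 0}"
      by (intro sum.mono_neutral_right) auto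
    also have "\<dots> \<le> sum q (h ` P)"
    proof (intro sum_mono2 subsetI)
      fix n assume "n \<in> {n\<in>{..<N}. q n \<noteq> 0}"
      then have n: "n < N" "\<not> prime n" "primepow n"
        by (auto simp: q_def mangoldt_def split: if_splits)
      then obtain p k where pk: "prime p" "k > 0" "n = p ^ k"
        by (auto simp: primepow_def)
      then have "k \<ge> 2" using n(2) by (cases "k = 1") auto
      then obtain j where j: "k = j + 2" by (metis add.commute le_Suc_ex)
      have "p > 1" using pk(1) prime_gt_1_nat by blast
      then have "p \<le> n" "k < n"
        using pk by (auto simp: self_le_power power_gt_expt)
      then have "(p, j) \<in> P" using n(1) pk(1) j by (simp add: P_def)
      moreover have "n = h (p, j)" by (simp add: h_def pk j)
      ultimately show "n \<in> h ` P" by blast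
    qed (use fin q0 in auto)
    \<comment> \<open>The terms are nonnegative, so repeated values of \<open>h\<close> could only
      enlarge the right-hand side.\<close>
    also have "\<dots> \<le> sum (q \<circ> h) P"
      using fin q0 by (intro sum_image_le) auto
    also have "\<dots> \<le> (\<Sum>(p, j)\<in>{..<N} \<times> {..<N}. a p * (1 / 2) ^ j)"
    proof (rule sum_mono2[THEN order_trans[rotated]])
      show "sum (q \<circ> h) P \<le> (\<Sum>(p, j)\<in>P. a p * (1 / 2) ^ j)"
      proof (intro sum_mono, clarify)
        fix p j assume "(p, j) \<in> P"
        then have p: "prime p" by (simp add: P_def)
        then have p2: "real p \<ge> 2" using prime_ge_2_nat[OF p] by simp
        have "(q \<circ> h) (p, j) \<le> ln (real p) / real p ^ (j + 2)"
          using p2 mangoldt_primepow'[OF p, of "j + 2", where 'a = real]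
          by (simp add: q_def h_def)
        also have "\<dots> = a p * (1 / real p) ^ j"
          using p2 by (simp add: a_def powr_minus powr_numeral power_add power_divide power2_eq_square field_simps)
        also have "\<dots> \<le> a p * (1 / 2) ^ j"
          using p2 by (intro mult_left_mono power_mono a divide_left_mono) auto
        finally show "(q \<circ> h) (p, j) \<le> a p * (1 / 2) ^ j" .
      qed
    qed (auto simp: P_def a)
    also have "\<dots> = (\<Sum>p<N. a p) * (\<Sum>j<N. (1 / 2) ^ j)"
      by (simp add: sum_product sum.cartesian_product)
    also have "\<dots> \<le> suminf a * (\<Sum>j. (1 / 2) ^ j)"
      by (intro mult_mono sum_le_suminf a suminf_nonneg sum_nonneg) auto
    finally show ?thesis by (simp add: suminf_geometric)
  qed
  then have "summable q"
    using q0 by (intro bounded_imp_summable[of q "suminf a * 2"])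
      (simp_all only: lessThan_Suc_atMost [symmetric])
  then show ?thesis unfolding q_def .
qed

text \<open>Twisting n powr (-i l t) by \<open>cis (l * y * t)\<close> moves the frequency ln n to
  ln n - y. Sum and integral are exchanged by dominated convergence, with the constant 2 from the
  bound on the kernel.\<close>

lemma selberg_minorant_mangoldt_sums:
  assumes "x > 1"
  shows "(\<lambda>n. mangoldt n * real n powr - x * selberg_minorant (l * (ln (real n) - y))) sums
           integral {0..1} (\<lambda>t. selberg_kernel t *
             Re (cis (l * y * t) * mangoldt_series (of_real x + \<i> * of_real (l * t))))"
proof -
  define w where "w n = mangoldt n * real n powr - x" for n
  define f where "f N t = (\<Sum>n<N. w n * (selberg_kernel t * cos (l * (ln (real n) - y) * t)))" for N t
  have w0: "w n \<ge> 0" for n by (simp add: w_def mangoldt_nonneg)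
  have sw: "summable w" unfolding w_def by (rule summable_mangoldt_powr[OF assms])
  have int: "(\<lambda>t. selberg_kernel t * cos (l * (ln (real n) - y) * t)) integrable_on {0..1}" for n
    by (intro integrable_continuous_interval continuous_intros)
  have intf: "f N integrable_on {0..1}" for N
    unfolding f_def by (intro integrable_sum integrable_on_mult_right int) auto
  have integral_f: "integral {0..1} (f N) = (\<Sum>n<N. w n * selberg_minorant (l * (ln (real n) - y)))" for N
    unfolding f_def selberg_minorant_def
    by (subst integral_sum) (auto intro!: integrable_on_mult_right int)
  have "(\<lambda>N. integral {0..1} (f N)) \<longlonglongrightarrow> integral {0..1} (\<lambda>t. selberg_kernel t *
             Re (cis (l * y * t) * mangoldt_series (of_real x + \<i> * of_real (l * t))))"
  proof (rule dominated_convergence(2)[OF intf, where h = "\<lambda>_. 2 * suminf w"])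
    fix N and t :: real assume t: "t \<in> {0..1}"
    have "norm (f N t) \<le> (\<Sum>n<N. norm (w n * (selberg_kernel t * cos (l * (ln (real n) - y) * t))))"
      unfolding f_def by (rule norm_sum)
    also have "\<dots> \<le> (\<Sum>n<N. w n * (2 * 1))"
      unfolding real_norm_def abs_mult abs_of_nonneg[OF w0]
      by (intro sum_mono mult_left_mono mult_mono abs_selberg_kernel_le t w0) auto
    also have "\<dots> = 2 * (\<Sum>n<N. w n)" by (simp add: sum_distrib_left mult.commute)
    also have "\<dots> \<le> 2 * suminf w"
      using sw w0 by (intro mult_left_mono sum_le_suminf) auto
    finally show "norm (f N t) \<le> 2 * suminf w" .
  next
    fix t :: real
    let ?s = "of_real x + \<i> * of_real (l * t) :: complex"
    have "(\<lambda>n. cis (l * y * t) * (mangoldt n * of_nat n powr - ?s)) sums (cis (l * y * t) * mangoldt_series ?s)"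
      using assms by (intro sums_mult mangoldt_series_sums) auto
    from sums_Re[OF this]
    have "(\<lambda>n. Re (cis (l * y * t) * (mangoldt n * of_nat n powr - ?s))) sums
        Re (cis (l * y * t) * mangoldt_series ?s)" .
    also have "(\<lambda>n. Re (cis (l * y * t) * (mangoldt n * of_nat n powr - ?s))) =
        (\<lambda>n. w n * cos (l * (ln (real n) - y) * t))"
    proof
      fix n
      have "cis (l * y * t) * (mangoldt n * of_nat n powr - ?s) =
          of_real (w n) * (cis (l * y * t) * cis (- (l * t * ln (real n))))"
        unfolding nat_powr_cis w_def by (simp add: mult_ac)
      also have "\<dots> = of_real (w n) * cis (- (l * (ln (real n) - y) * t))"
        unfolding cis_mult by (simp add: algebra_simps)
      finally show "Re (cis (l * y * t) * (mangoldt n * of_nat n powr - ?s)) = w n * cos (l * (ln (real n) - y) * t)"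
        by simp
    qed
    finally have "(\<lambda>n. selberg_kernel t * (w n * cos (l * (ln (real n) - y) * t))) sums
        (selberg_kernel t * Re (cis (l * y * t) * mangoldt_series ?s))"
      by (rule sums_mult)
    then show "(\<lambda>N. f N t) \<longlonglongrightarrow> selberg_kernel t * Re (cis (l * y * t) * mangoldt_series ?s)"
      unfolding f_def sums_def by (simp add: mult_ac)
  qed auto
  then show ?thesis
    unfolding integral_f sums_def w_def .
qed

text \<open>Compare term by term. Outside the window the minorant is nonpositive; inside it n is not
  prime by \<open>gap\<close> and n >= N, the minorant is at most 2 and n powr -x is at most 1/n.
  The bound is uniform in x, which allows x to tend to 1.\<close>

lemma selberg_integral_le_prime_free:
  assumes "x > 1" "l > 0" "real N \<le> exp (y - 2 * pi / l)"
    and gap: "\<And>p. prime p \<Longrightarrow> \<bar>ln (real p) - y\<bar> > 2 * pi / l"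
  shows "integral {0..1} (\<lambda>t. selberg_kernel t *
             Re (cis (l * y * t) * mangoldt_series (of_real x + \<i> * of_real (l * t))))
         \<le> 2 * (\<Sum>n. if n < N \<or> prime n then 0 else mangoldt n / real n)"
proof -
  define q where "q n = (if n < N \<or> prime n then 0 else mangoldt n / real n)" for n
  have "summable q"
    by (rule summable_comparison_test'[OF summable_mangoldt_nonprime, of 0])
       (auto simp: q_def mangoldt_nonneg)
  then have "(\<lambda>n. 2 * q n) sums (2 * suminf q)"
    by (intro sums_mult summable_sums)
  moreover have "mangoldt n * real n powr - x * selberg_minorant (l * (ln (real n) - y)) \<le> 2 * q n" for n
  proof (cases "n = 0 \<or> \<bar>l * (ln (real n) - y)\<bar> > 2 * pi")
    case True
    then have "mangoldt n * real n powr - x * selberg_minorant (l * (ln (real n) - y)) \<le> 0"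
      by (cases "n = 0") (auto intro!: mult_nonneg_nonpos selberg_minorant_nonpos simp: mangoldt_nonneg)
    also have "0 \<le> 2 * q n" by (simp add: q_def mangoldt_nonneg)
    finally show ?thesis .
  next
    case False
    then have n: "n > 0" and "l * \<bar>ln (real n) - y\<bar> \<le> 2 * pi"
      using assms(2) by (auto simp only: abs_mult not_less abs_of_pos)
    then have n: "n > 0" "\<bar>ln (real n) - y\<bar> \<le> 2 * pi / l"
      using assms(2) by (simp_all add: pos_le_divide_eq mult.commute)
    then have "\<not> prime n" using gap[of n] by auto
    moreover have "\<not> n < N"
    proof
      assume "n < N"
      then have "real n < exp (y - 2 * pi / l)" using assms(3) by simp
      then have "ln (real n) < y - 2 * pi / l"
        using n(1) by (subst (asm) ln_less_cancel_iff [symmetric]) auto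
      with n(2) show False by linarith
    qed
    ultimately have q: "q n = mangoldt n / real n" by (simp add: q_def)
    have "mangoldt n * real n powr - x * selberg_minorant (l * (ln (real n) - y)) \<le>
        mangoldt n * real n powr - x * 2"
      using abs_selberg_minorant_le[of "l * (ln (real n) - y)"]
      by (intro mult_left_mono mangoldt_nonneg mult_nonneg_nonneg) auto
    also have "\<dots> \<le> mangoldt n * real n powr - 1 * 2"
      using n(1) assms(1) by (intro mult_right_mono mult_left_mono powr_mono mangoldt_nonneg) auto
    also have "\<dots> = 2 * q n"
      using n(1) by (simp add: q powr_minus divide_inverse)
    finally show ?thesis .
  qed
  ultimately show ?thesis
    unfolding q_def by (intro sums_le[OF _ selberg_minorant_mangoldt_sums[OF assms(1)]])
qed

section \<open>The limit x to 1 from the right\<close>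

text \<open>This is -zeta'/zeta - 1/(s - 1), written so that s = 1 is an ordinary point.\<close>

definition zeta_regular_part :: "complex \<Rightarrow> complex" where
  "zeta_regular_part s = - deriv zeta1 s / zeta1 s"

lemma continuous_on_zeta_regular_part: "continuous_on {s. Re s \<ge> 1} zeta_regular_part"
proof -
  have "continuous_on {s. Re s > 0} zeta1" "continuous_on {s. Re s > 0} (deriv zeta1)"
    by (intro holomorphic_on_imp_continuous_on holomorphic_deriv zeta1_holomorphic
          open_halfspace_Re_gt)+
  then have "continuous_on {s. Re s \<ge> 1} zeta1" "continuous_on {s. Re s \<ge> 1} (deriv zeta1)"
    by (auto elim!: continuous_on_subset)
  then show ?thesis
    unfolding zeta_regular_part_def [abs_def] by (intro continuous_intros) (auto simp: zeta1_nonzero)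
qed

lemma mangoldt_series_split:
  "Re s > 1 \<Longrightarrow> mangoldt_series s = 1 / (s - 1) + zeta_regular_part s"
  by (simp add: mangoldt_series_eq zeta1_nonzero zeta_regular_part_def)

text \<open>The two summands carry the Poisson kernel and the conjugate Poisson kernel in b. They
  behave differently as h tends to 0 and are treated separately.\<close>

lemma Re_cis_div: "Re (cis a / (of_real h + \<i> * of_real b)) = h * cos a / (h\<^sup>2 + b\<^sup>2) + b * sin a / (h\<^sup>2 + b\<^sup>2)"
  by (simp add: Re_divide add_divide_distrib mult.commute)

text \<open>The part of the pole term that concentrates at \<^term>\<open>t = 0\<close> is asymptotically nonnegative, so it
  can be dropped.\<close>
lemma Poisson_term_lower_bound:
  assumes "l > 0" "y > 0"
  obtains C where "\<And>h t. h > 0 \<Longrightarrow> t \<in> {0..1} \<Longrightarrow>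
    - (C * h) \<le> selberg_kernel t * (h * cos (y * t) / (h\<^sup>2 + (l * t)\<^sup>2))"
proof
  \<comment> \<open>Up to \<tau>, the bound y t <= 1 < pi/2 makes the cosine nonnegative and t <=
    1/2 makes the kernel nonnegative. Beyond \<tau> the denominator is at least (l \<tau>)^2, and
    the kernel bound 2 gives \<open>C\<close>. Both depend on y, which stays fixed while h tends to
    0.\<close>
  define \<tau> where "\<tau> = min (1 / 2) (1 / y)"
  define C where "C = 2 / (l * \<tau>)\<^sup>2"
  have \<tau>: "\<tau> > 0" "\<tau> \<le> 1 / 2" "y * \<tau> \<le> 1"
    using assms by (auto simp: \<tau>_def min_def field_simps)
  fix h t :: real assume h: "h > 0" and t: "t \<in> {0..1}"
  show "- (C * h) \<le> selberg_kernel t * (h * cos (y * t) / (h\<^sup>2 + (l * t)\<^sup>2))"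
  proof (cases "t \<le> \<tau>")
    case True
    have "y * t \<le> 1" using mult_left_mono[OF True, of y] \<tau>(3) assms by linarith
    moreover have "y * t \<ge> 0" using assms t by simp
    ultimately have "cos (y * t) \<ge> 0" using pi_gt3 by (intro cos_ge_zero) auto
    moreover have "selberg_kernel t \<ge> 0"
      using True \<tau> t by (intro selberg_kernel_nonneg) auto
    ultimately have "0 \<le> selberg_kernel t * (h * cos (y * t) / (h\<^sup>2 + (l * t)\<^sup>2))"
      using h by (intro mult_nonneg_nonneg divide_nonneg_nonneg) auto
    moreover have "C * h \<ge> 0" using h by (simp add: C_def)
    ultimately show ?thesis by linarith
  next
    case False
    have sq: "(l * \<tau>)\<^sup>2 \<le> h\<^sup>2 + (l * t)\<^sup>2"
      using False \<tau> assms power_mono[of "l * \<tau>" "l * t" 2] zero_le_power2[of h]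
      by (smt (verit) mult_left_mono mult_nonneg_nonneg)
    have pos: "(l * \<tau>)\<^sup>2 > 0" using assms \<tau> by simp
    have "\<bar>selberg_kernel t * (h * cos (y * t) / (h\<^sup>2 + (l * t)\<^sup>2))\<bar>
        \<le> 2 * (h * 1 / (l * \<tau>)\<^sup>2)"
      unfolding abs_mult abs_divide
      using sq pos h abs_selberg_kernel_le[OF t]
      by (intro mult_mono frac_le) auto
    also have "2 * (h * 1 / (l * \<tau>)\<^sup>2) = C * h" by (simp add: C_def)
    finally show ?thesis by (subst minus_le_iff) (rule abs_le_D2)
  qed
qed

text \<open>Put x = 1 + h and let h tend to 0 for fixed y. The regular part \<open>B\<close> and the
  conjugate Poisson part \<open>A\<close> converge under dominated convergence; the Poisson part is
  replaced by its lower bound -C h, which disappears in the limit.\<close>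

lemma selberg_integral_prime_free_limit:
  assumes l: "l > 0" and y: "y > 0" and N: "real N \<le> exp (y - 2 * pi / l)"
    and gap: "\<And>p. prime p \<Longrightarrow> \<bar>ln (real p) - y\<bar> > 2 * pi / l"
  shows "integral {0..1} (\<lambda>t. selberg_kernel t * (l * y * sinc (l * y * t))) / l
      + integral {0..1} (\<lambda>t. Re (cis (l * y * t) *
          (of_real (selberg_kernel t) * zeta_regular_part (1 + \<i> * of_real (l * t)))))
      \<le> 2 * (\<Sum>n. if n < N \<or> prime n then 0 else mangoldt n / real n)" (is "?I1 / l + ?I2 \<le> ?V")
proof -
  define Y where "Y = l * y"
  have Y: "Y > 0" using l y by (simp add: Y_def)
  define B where "B h t = Re (cis (Y * t) * (of_real (selberg_kernel t) *
      zeta_regular_part (of_real (1 + h) + \<i> * of_real (l * t))))" for h t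
  (* Division by zero makes A 0 0 = 0, which is the limit of A h 0 but not of A 0 t as t tends to 0. *)
  define A where "A h t = selberg_kernel t * (l * t * sin (Y * t) / (h\<^sup>2 + (l * t)\<^sup>2))" for h t
  define hk where "hk k = 1 / real (Suc k)" for k
  have hk: "hk k > 0" "hk k \<le> 1" for k by (auto simp: hk_def)
  have hk0: "hk \<longlonglongrightarrow> 0" unfolding hk_def using LIMSEQ_inverse_real_of_nat by (simp add: divide_inverse)
  have contB: "continuous_on {0..1} (B h)" if "h \<ge> 0" for h
    unfolding B_def using that
    by (intro continuous_intros continuous_on_of_real
          continuous_on_compose2[OF continuous_on_zeta_regular_part]) auto
  have contA: "continuous_on {0..1} (A h)" if "h > 0" for h
  proof -
    have "h\<^sup>2 + (l * t)\<^sup>2 \<noteq> 0" for t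
      using that zero_less_power2[of h] zero_le_power2[of "l * t"] by linarith
    then show ?thesis unfolding A_def by (intro continuous_intros) auto
  qed
  note int = integrable_continuous_interval
  \<comment> \<open>This rectangle contains every point 1 + h + i l t with h and t in [0, 1], which
    gives one bound \<open>D\<close> for all of them.\<close>
  have "compact (zeta_regular_part ` cbox (Complex 1 0) (Complex 2 l))"
    by (rule compact_continuous_image[OF continuous_on_subset[OF continuous_on_zeta_regular_part]])
       (auto simp: in_cbox_complex_iff)
  from compact_imp_bounded[OF this]
  obtain D where "\<forall>z \<in> zeta_regular_part ` cbox (Complex 1 0) (Complex 2 l). norm z \<le> D"
    unfolding bounded_iff by (elim exE)
  then have D: "norm (zeta_regular_part (of_real (1 + h) + \<i> * of_real (l * t))) \<le> D"
      if "0 \<le> h" "h \<le> 1" "t \<in> {0..1}" for h t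
    by (rule bspec[OF _ imageI]) (use that l mult_left_mono[of t 1 l] in \<open>simp add: in_cbox_complex_iff\<close>)
  have limB: "(\<lambda>k. integral {0..1} (B (hk k))) \<longlonglongrightarrow> integral {0..1} (B 0)"
  proof (rule dominated_convergence(2)[where h = "\<lambda>_. 2 * D"])
    show "B (hk k) integrable_on {0..1}" for k
      using hk[of k] by (intro int contB) auto
    show "norm (B (hk k) t) \<le> 2 * D" if t: "t \<in> {0..1}" for k t
    proof -
      have "norm (B (hk k) t) \<le> norm (cis (Y * t) * (of_real (selberg_kernel t) *
          zeta_regular_part (of_real (1 + hk k) + \<i> * of_real (l * t))))"
        unfolding B_def real_norm_def by (rule abs_Re_le_cmod)
      also have "\<dots> \<le> 2 * D"
        unfolding norm_mult using hk[of k] abs_selberg_kernel_le[OF t] D[of "hk k" t] t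
        by (simp del: of_real_add of_real_mult) (intro mult_mono, auto)
      finally show ?thesis .
    qed
    show "(\<lambda>k. B (hk k) t) \<longlonglongrightarrow> B 0 t" for t
    proof -
      have "((\<lambda>k. of_real (1 + hk k) + \<i> * of_real (l * t)) \<longlongrightarrow> of_real (1 + 0) + \<i> * of_real (l * t)) sequentially"
        by (intro tendsto_intros hk0)
      then have "(\<lambda>k. zeta_regular_part (of_real (1 + hk k) + \<i> * of_real (l * t))) \<longlonglongrightarrow>
          zeta_regular_part (of_real (1 + 0) + \<i> * of_real (l * t))"
        by (rule continuous_on_tendsto_compose[OF continuous_on_zeta_regular_part])
           (use hk in \<open>auto intro!: always_eventually simp: less_imp_le\<close>)
      then show ?thesis unfolding B_def by (intro tendsto_intros)
    qed
  qed auto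
  have limA: "(\<lambda>k. integral {0..1} (A (hk k))) \<longlonglongrightarrow> ?I1 / l"
  proof -
    have "(\<lambda>k. integral {0..1} (A (hk k))) \<longlonglongrightarrow> integral {0..1} (A 0)"
    proof (rule dominated_convergence(2)[where h = "\<lambda>_. 2 * (Y / l)"])
      show "A (hk k) integrable_on {0..1}" for k
        using hk[of k] by (intro int contA) auto
      show "norm (A (hk k) t) \<le> 2 * (Y / l)" if t: "t \<in> {0..1}" for k t
      proof (cases "t = 0")
        case False
        \<comment> \<open>As |sin(Y t)| <= Y t, the numerator is of order t^2 and cancels the
          denominator uniformly in h.\<close>
        have "\<bar>l * t * sin (Y * t) / ((hk k)\<^sup>2 + (l * t)\<^sup>2)\<bar> \<le> (l * t) * (Y * t) / (l * t)\<^sup>2"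
          unfolding abs_mult abs_divide using abs_sin_x_le_abs_x[of "Y * t"] False t l Y
          by (intro frac_le mult_mono) (auto simp: abs_mult)
        also have "\<dots> = Y / l" using False l by (simp add: power2_eq_square)
        finally show ?thesis
          unfolding A_def real_norm_def abs_mult[of "selberg_kernel t"]
          by (intro mult_mono abs_selberg_kernel_le t) auto
      qed (use Y l in \<open>auto simp: A_def\<close>)
      show "(\<lambda>k. A (hk k) t) \<longlonglongrightarrow> A 0 t" if "t \<in> {0..1}" for t
      proof (cases "t = 0")
        case False
        then show ?thesis unfolding A_def using l by (intro tendsto_intros hk0) auto
      qed (auto simp: A_def)
    qed auto
    also have "integral {0..1} (A 0) = integral {0..1} (\<lambda>t. selberg_kernel t * (Y * sinc (Y * t)) / l)"
    \<comment> \<open>The integrands differ at t = 0: \<open>A 0\<close> is 0 there, whereas the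
      sinc form is Y / l.\<close>
    proof (rule integral_spike[of "{0}"])
      show "selberg_kernel t * (Y * sinc (Y * t)) / l = A 0 t" if "t \<in> {0..1} - {0}" for t
        using that l Y by (simp add: A_def power2_eq_square field_simps)
    qed auto
    also have "\<dots> = ?I1 / l" by (simp only: Y_def integral_divide)
    finally show ?thesis .
  qed
  obtain C where C: "\<And>h t. h > 0 \<Longrightarrow> t \<in> {0..1} \<Longrightarrow>
      - (C * h) \<le> selberg_kernel t * (h * cos (Y * t) / (h\<^sup>2 + (l * t)\<^sup>2))"
    using Poisson_term_lower_bound[OF l Y] by metis
  have le: "integral {0..1} (A h) + integral {0..1} (B h) - C * h \<le> ?V" if h: "h > 0" for h
  proof -
    have "integral {0..1} (A h) + integral {0..1} (B h) - C * h = integral {0..1} (\<lambda>t. A h t + B h t - C * h)"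
      using h by (subst integral_diff, simp_all add: integral_add int contA contB integrable_add)
    also have "\<dots> \<le> integral {0..1} (\<lambda>t. selberg_kernel t *
        Re (cis (l * y * t) * mangoldt_series (of_real (1 + h) + \<i> * of_real (l * t))))"
    proof -
      have eq: "selberg_kernel t * Re (cis (l * y * t) * mangoldt_series (of_real (1 + h) + \<i> * of_real (l * t)))
         = selberg_kernel t * (h * cos (Y * t) / (h\<^sup>2 + (l * t)\<^sup>2)) + A h t + B h t" for t
      proof -
        have "of_real (1 + h) + \<i> * of_real (l * t) - 1 = of_real h + \<i> * of_real (l * t)"
          by simp
        then have "Re (cis (Y * t) * mangoldt_series (of_real (1 + h) + \<i> * of_real (l * t))) =
            Re (cis (Y * t) / (of_real h + \<i> * of_real (l * t))) +
            Re (cis (Y * t) * zeta_regular_part (of_real (1 + h) + \<i> * of_real (l * t)))"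
          using h by (subst mangoldt_series_split) (simp_all add: distrib_left)
        then show ?thesis
          unfolding Re_cis_div A_def B_def Y_def
          by (simp add: distrib_left mult.left_commute)
      qed
      have cont: "continuous_on {0..1} (\<lambda>t. selberg_kernel t * (h * cos (Y * t) / (h\<^sup>2 + (l * t)\<^sup>2)))"
      proof -
        have "h\<^sup>2 + (l * t)\<^sup>2 \<noteq> 0" for t
          using h zero_less_power2[of h] zero_le_power2[of "l * t"] by linarith
        then show ?thesis by (intro continuous_intros) auto
      qed
      show ?thesis unfolding eq
      proof (rule integral_le)
        show "(\<lambda>t. A h t + B h t - C * h) integrable_on {0..1}"
          using h by (intro int continuous_intros contA contB) auto
        show "(\<lambda>t. selberg_kernel t * (h * cos (Y * t) / (h\<^sup>2 + (l * t)\<^sup>2)) + A h t + B h t) integrable_on {0..1}"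
          using h by (intro int continuous_intros contA contB cont) auto
      qed (use C[OF h] in force)
    qed
    also have "\<dots> \<le> ?V"
      using h by (intro selberg_integral_le_prime_free l N gap) auto
    finally show ?thesis .
  qed
  have "(\<lambda>k. integral {0..1} (A (hk k)) + integral {0..1} (B (hk k)) - C * hk k) \<longlonglongrightarrow>
      ?I1 / l + integral {0..1} (B 0) - C * 0"
    by (intro tendsto_intros limA limB hk0)
  then have "?I1 / l + integral {0..1} (B 0) - C * 0 \<le> ?V"
    by (rule LIMSEQ_le_const2) (use le hk in auto)
  then show ?thesis by (simp add: B_def[abs_def] Y_def)
qed

section \<open>Gaps between primes\<close>

text \<open>In a prime-free window the main term, which tends to pi / (2 l), would be at most twice
  a tail of the sum over proper prime powers.\<close>

lemma eventually_prime_near_exp: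
  assumes l: "l > 0"
  shows "eventually (\<lambda>y. \<exists>p::nat. prime p \<and> \<bar>ln (real p) - y\<bar> \<le> 2 * pi / l) at_top"
proof -
  define q :: "nat \<Rightarrow> real" where "q n = (if prime n then 0 else mangoldt n / real n)" for n
  define T where "T N = (\<Sum>n. if n < N \<or> prime n then 0 else mangoldt n / real n)" for N
  define G where "G t = of_real (selberg_kernel t) * zeta_regular_part (1 + \<i> * of_real (l * t))" for t
  have contG: "continuous_on {0..1} G"
    unfolding G_def
    by (intro continuous_intros continuous_on_of_real
          continuous_on_compose2[OF continuous_on_zeta_regular_part]) auto
  define I where "I y = integral {0..1} (\<lambda>t. selberg_kernel t * (l * y * sinc (l * y * t))) / l
      + integral {0..1} (\<lambda>t. Re (cis (l * y * t) * G t))" for y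
  have "integral {0..1} (\<lambda>t. Re (cis (l * y * t) * G t)) = Re (integral {0..1} (\<lambda>t. cis (l * y * t) * G t))" for y
    by (intro integral_unique has_integral_Re integrable_integral integrable_continuous_interval
          continuous_intros contG)
  moreover have lim: "filterlim (\<lambda>y. l * y) at_top at_top"
    using l by (intro filterlim_tendsto_pos_mult_at_top[OF tendsto_const] filterlim_ident)
  have "((\<lambda>y. integral {0..1} (\<lambda>t. selberg_kernel t * (l * y * sinc (l * y * t))) / l
      + Re (integral {0..1} (\<lambda>t. cis (l * y * t) * G t))) \<longlongrightarrow> pi / 2 / l + Re 0) at_top"
    using l by (intro tendsto_intros filterlim_compose[OF selberg_kernel_Dirichlet_limit lim]
        filterlim_compose[OF Riemann_Lebesgue_continuous[OF contG] lim]) auto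
  ultimately have "(I \<longlongrightarrow> pi / 2 / l) at_top"
    unfolding I_def by simp
  \<comment> \<open>Half of the limit is kept as a margin. A tail below pi / (8 l), doubled, then
    stays below it.\<close>
  then have 1: "eventually (\<lambda>y. I y > pi / 4 / l) at_top"
    by (rule order_tendstoD(1)) (rule divide_strict_right_mono, use l in simp_all)
  have T: "T N = suminf q - (\<Sum>n<N. q n)" for N
  proof -
    have "(\<lambda>n. q n - (if n \<in> {..<N} then q n else 0)) sums (suminf q - (\<Sum>n<N. q n))"
      by (intro sums_diff sums_If_finite_set summable_sums)
         (use summable_mangoldt_nonprime in \<open>auto simp: q_def[abs_def]\<close>)
    also have "(\<lambda>n. q n - (if n \<in> {..<N} then q n else 0)) =
        (\<lambda>n. if n < N \<or> prime n then 0 else mangoldt n / real n)"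
      by (auto simp: q_def)
    finally show ?thesis by (simp add: T_def sums_iff)
  qed
  have "(\<lambda>N. suminf q - (\<Sum>n<N. q n)) \<longlonglongrightarrow> suminf q - suminf q"
    using summable_mangoldt_nonprime
    by (intro tendsto_intros summable_LIMSEQ) (simp add: q_def[abs_def])
  then have "T \<longlonglongrightarrow> 0" by (simp add: T[abs_def])
  then have "eventually (\<lambda>N. T N < pi / 8 / l) sequentially"
    by (rule order_tendstoD(2)) (use l in simp)
  then obtain N where N: "T N < pi / 8 / l" "N > 0"
    by (metis (no_types, lifting) eventually_sequentially le_SucI nle_le zero_less_Suc)
  show ?thesis
    \<comment> \<open>The last condition places the whole window above ln N.\<close>
    using 1 eventually_gt_at_top[of 0] eventually_ge_at_top[of "ln (real N) + 2 * pi / l"]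
  proof eventually_elim
    case (elim y)
    have "ln (real N) \<le> y - 2 * pi / l" using elim by linarith
    then have "exp (ln (real N)) \<le> exp (y - 2 * pi / l)" by (simp only: exp_le_cancel_iff)
    then have Ny: "real N \<le> exp (y - 2 * pi / l)" using N by simp
    show ?case
    proof (rule ccontr)
      assume "\<not> ?case"
      then have "\<bar>ln (real p) - y\<bar> > 2 * pi / l" if "prime p" for p :: nat
        using that by (auto simp: not_le)
      from selberg_integral_prime_free_limit[OF l _ Ny this]
      have "I y \<le> 2 * T N" using elim by (simp only: I_def T_def G_def)
      with elim N show False by simp
    qed
  qed
qed

section \<open>From windows in ln p to consecutive primes\<close>

lemma nth_prime_mono: "1 \<le> m \<Longrightarrow> m \<le> n \<Longrightarrow> nth_prime m \<le> nth_prime n"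
  using strict_mono_on_leD[OF strict_mono_on_nth_prime, of m n] by simp

lemma nth_prime_pos: "nth_prime n > 0"
  using prime_gt_0_nat prime_nth_prime by blast

lemma filterlim_nth_prime: "filterlim (\<lambda>n. real (nth_prime n)) at_top sequentially"
proof (rule filterlim_at_top_mono)
  \<comment> \<open>The shift by 1 arises because \<open>nth_prime n\<close> is entry n - 1 of the
    enumeration.\<close>
  show "filterlim (\<lambda>n. - 1 + real n) at_top sequentially"
    by (rule filterlim_tendsto_add_at_top[OF tendsto_const filterlim_real_sequentially])
  have "n - 1 \<le> nth_prime n" for n
    unfolding nth_prime_def by (rule le_enumerate) (rule primes_infinite)
  then have "- 1 + real n \<le> real (nth_prime n)" for n
    using of_nat_mono[of n "nth_prime n + 1", where 'a = real] by (simp add: le_diff_conv)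
  then show "eventually (\<lambda>n. - 1 + real n \<le> real (nth_prime n)) sequentially"
    by (intro always_eventually allI)
qed

lemma eventually_nth_prime_Suc_le:
  assumes "r > 1"
  shows "eventually (\<lambda>n. real (nth_prime (Suc n)) \<le> r * real (nth_prime n)) sequentially"
proof -
  \<comment> \<open>This makes the window half-width ln r / 4. Centred at ln p_n + (ln r) / 2, the
    window lies strictly between ln p_n and ln (r p_n), so a prime in it exceeds p_n and bounds
    p_(n+1) from above.\<close>
  define l where "l = 8 * pi / ln r"
  have lr: "ln r > 0" using assms by simp
  have l: "l > 0" "2 * pi / l = ln r / 4"
    using lr by (simp_all add: l_def)
  have lim: "filterlim (\<lambda>n. ln r / 2 + ln (real (nth_prime n))) at_top sequentially"
    by (intro filterlim_tendsto_add_at_top[OF tendsto_const] filterlim_compose[OF ln_at_top]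
        filterlim_nth_prime)
  have "eventually (\<lambda>n. \<exists>p::nat. prime p \<and>
      \<bar>ln (real p) - (ln r / 2 + ln (real (nth_prime n)))\<bar> \<le> ln r / 4) sequentially"
    using filterlim_iff[THEN iffD1, OF lim, rule_format, OF eventually_prime_near_exp[OF l(1)]]
    unfolding l(2) .
  then show ?thesis
    using eventually_ge_at_top[of 1]
  proof eventually_elim
    case (elim n)
    then obtain p :: nat where p: "prime p" "\<bar>ln (real p) - (ln r / 2 + ln (real (nth_prime n)))\<bar> \<le> ln r / 4"
      by blast
    have pp: "real p > 0" "real (nth_prime n) > 0"
      using p(1) nth_prime_pos prime_gt_0_nat by auto
    have "ln (real (nth_prime n)) < ln (real p)" using p(2) lr by linarith
    then have gt: "nth_prime n < p" using pp by simp
    have "ln (real p) \<le> ln r + ln (real (nth_prime n))" using p(2) lr by linarith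
    also have "\<dots> = ln (r * real (nth_prime n))" using assms pp by (simp add: ln_mult)
    finally have le: "real p \<le> r * real (nth_prime n)" using assms pp by simp
    obtain m where m: "m \<ge> 1" "nth_prime m = p" using nth_prime_surj[OF p(1)] by blast
    have "m > n"
      using gt m nth_prime_mono[of m n] by (cases "m \<le> n") auto
    then have "nth_prime (Suc n) \<le> p" using nth_prime_mono[of "Suc n" m] m by simp
    with le show ?case by linarith
  qed
qed

lemma nth_prime_ratio_tendsto: "(\<lambda>n. real (nth_prime n) / real (nth_prime (Suc n))) \<longlonglongrightarrow> 1"
proof -
  have "(\<lambda>n. real (nth_prime (Suc n)) / real (nth_prime n)) \<longlonglongrightarrow> 1"
  proof (rule order_tendstoI)
    fix a :: real assume "a < 1"
    show "eventually (\<lambda>n. a < real (nth_prime (Suc n)) / real (nth_prime n)) sequentially"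
      using eventually_ge_at_top[of 1]
    proof eventually_elim
      case (elim n)
      have "1 \<le> real (nth_prime (Suc n)) / real (nth_prime n)"
        using nth_prime_mono[of n "Suc n"] nth_prime_pos[of n] elim by simp
      with \<open>a < 1\<close> show ?case by linarith
    qed
  next
    fix a :: real assume a: "1 < a"
    \<comment> \<open>The midpoint of 1 and a is still above 1 and turns the weak inequality into a
      strict one.\<close>
    then have "eventually (\<lambda>n. real (nth_prime (Suc n)) \<le> (1 + a) / 2 * real (nth_prime n)) sequentially"
      by (intro eventually_nth_prime_Suc_le) simp
    then show "eventually (\<lambda>n. real (nth_prime (Suc n)) / real (nth_prime n) < a) sequentially"
    proof eventually_elim
      case (elim n)
      then have "real (nth_prime (Suc n)) / real (nth_prime n) \<le> (1 + a) / 2"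
        using nth_prime_pos[of n] by (simp add: pos_divide_le_eq)
      also have "\<dots> < a" using a by simp
      finally show ?case .
    qed
  qed
  from tendsto_inverse[OF this] show ?thesis by simp
qed

theorem theorem4:
  fixes k \<epsilon> :: real
  assumes "\<epsilon> > 0"
  shows "\<exists>N::nat. N > 0 \<and> (\<forall>n\<ge>N.
           (2 - \<epsilon>) * real (nth_prime (n + 2)) powr k
             < real (nth_prime (n + 1)) powr k + real (nth_prime n) powr k \<and>
           real (nth_prime (n + 1)) powr k + real (nth_prime n) powr k
             < (2 + \<epsilon>) * real (nth_prime (n + 2)) powr k)"
proof -
  define p where "p n = real (nth_prime n)" for n
  have p: "p n > 0" for n by (simp add: p_def nth_prime_pos)
  have lim0: "(\<lambda>n. p n / p (n + 1)) \<longlonglongrightarrow> 1"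
    using nth_prime_ratio_tendsto by (simp add: p_def)
  have lim1: "(\<lambda>n. p (n + 1) / p (n + 2)) \<longlonglongrightarrow> 1"
    using LIMSEQ_Suc[OF lim0] by simp
  \<comment> \<open>After division by p_(n+2)^k, continuity of x^k at x = 1 suffices, for every real
    k. The two-step ratio is a product of two consecutive ratios.\<close>
  have "(\<lambda>n. (p (n + 1) / p (n + 2)) powr k + (p n / p (n + 1) * (p (n + 1) / p (n + 2))) powr k)
      \<longlonglongrightarrow> 1 powr k + (1 * 1) powr k"
    by (intro tendsto_intros lim0 lim1) auto
  moreover have "p n / p (n + 1) * (p (n + 1) / p (n + 2)) = p n / p (n + 2)" for n
    using p[of "n + 1"] by simp
  ultimately have lim: "(\<lambda>n. (p (n + 1) powr k + p n powr k) / p (n + 2) powr k) \<longlonglongrightarrow> 2"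
    using p by (simp add: powr_divide less_imp_le add_divide_distrib less_imp_neq[THEN not_sym])
  have "eventually (\<lambda>n. 2 - \<epsilon> < (p (n + 1) powr k + p n powr k) / p (n + 2) powr k \<and>
      (p (n + 1) powr k + p n powr k) / p (n + 2) powr k < 2 + \<epsilon>) sequentially"
    using assms by (intro eventually_conj order_tendstoD[OF lim]) auto
  then obtain N where N: "\<And>n. n \<ge> N \<Longrightarrow> 2 - \<epsilon> < (p (n + 1) powr k + p n powr k) / p (n + 2) powr k \<and>
      (p (n + 1) powr k + p n powr k) / p (n + 2) powr k < 2 + \<epsilon>"
    by (auto simp: eventually_sequentially)
  have "p (n + 2) powr k > 0" for n using p[of "n + 2"] by simp
  then show ?thesis
    using N by (intro exI[of _ "Suc N"]) (auto simp: p_def pos_less_divide_eq pos_divide_less_eq)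
qed

end
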